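(* Let $(P,\omega)$ be a sign-graded labeled poset with $p$ elements and rank $r$. Then $W(P,\omega;t)\in S_+^{p-r-1}$; that is, $$W(P,\omega;t)=\sum_{i=0}^{\lfloor (p-r-1)/2\rfloor}a_i\,t^i(1+t)^{p-r-1-2i}$$ with all $a_i\ge0$.
   Context: A labeled poset is a finite nonempty poset $P$ with $p$ elements and a bijection $\omega:P\to\{1,\dots,p\}$. Write $x\prec y$ if $y$ covers $x$; $\omega$ induces $\epsilon(x,y)=1$ if $\omega(x)<\omega(y)$ and $-1$ otherwise on covering pairs. $(P,\omega)$ is sign-graded if $\sum_{i=1}^n\epsilon(x_{i-1},x_i)$ is the same for every maximal chain $x_0\prec\cdots\prec x_n$ of $P$; this common value is the rank $r$. The $W$-polynomial is $W(P,\omega;t)=\sum_{\pi\in\mathcal{L}(P,\omega)}t^{\mathrm{des}(\pi)}$, where $\mathcal{L}(P,\omega)$ is the set of permutations $\omega(x_1)\cdots\omega(x_p)$ for linear extensions $x_1,\dots,x_p$ of $P$ and $\mathrm{des}(\pi)$ is the number of $i$ with $\pi_i>\pi_{i+1}$. $S^d_+$ denotes the set of non-negative linear combinations of $t^i(1+t)^{d-2i}$, $0\le i\le\lfloor d/2\rfloor$. *)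

theory Defs
  imports Main "HOL-Computational_Algebra.Polynomial"
begin

definition partial_order_on' :: "'a set \<Rightarrow> ('a \<Rightarrow> 'a \<Rightarrow> bool) \<Rightarrow> bool" where
  "partial_order_on' P le \<longleftrightarrow>
     (\<forall>x\<in>P. le x x) \<and>
     (\<forall>x\<in>P. \<forall>y\<in>P. le x y \<and> le y x \<longrightarrow> x = y) \<and>
     (\<forall>x\<in>P. \<forall>y\<in>P. \<forall>z\<in>P. le x y \<and> le y z \<longrightarrow> le x z)"

definition labeled_poset :: "'a set \<Rightarrow> ('a \<Rightarrow> 'a \<Rightarrow> bool) \<Rightarrow> ('a \<Rightarrow> nat) \<Rightarrow> bool" where
  "labeled_poset P le \<omega> \<longleftrightarrow> finite P \<and> P \<noteq> {} \<and> partial_order_on' P le \<and>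
     bij_betw \<omega> P {1..card P}"

definition covers :: "'a set \<Rightarrow> ('a \<Rightarrow> 'a \<Rightarrow> bool) \<Rightarrow> 'a \<Rightarrow> 'a \<Rightarrow> bool" where
  "covers P le x y \<longleftrightarrow> x \<in> P \<and> y \<in> P \<and> le x y \<and> x \<noteq> y \<and>
     \<not> (\<exists>z\<in>P. le x z \<and> le z y \<and> z \<noteq> x \<and> z \<noteq> y)"

definition maximal_chain :: "'a set \<Rightarrow> ('a \<Rightarrow> 'a \<Rightarrow> bool) \<Rightarrow> 'a list \<Rightarrow> bool" where
  "maximal_chain P le xs \<longleftrightarrow> xs \<noteq> [] \<and> set xs \<subseteq> P \<and>
     (\<forall>i. Suc i < length xs \<longrightarrow> covers P le (xs ! i) (xs ! Suc i)) \<and>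
     (\<forall>z\<in>P. le z (hd xs) \<longrightarrow> z = hd xs) \<and>
     (\<forall>z\<in>P. le (last xs) z \<longrightarrow> z = last xs)"

definition eps :: "('a \<Rightarrow> nat) \<Rightarrow> 'a \<Rightarrow> 'a \<Rightarrow> int" where
  "eps \<omega> x y = (if \<omega> x < \<omega> y then 1 else -1)"

definition chain_sign :: "('a \<Rightarrow> nat) \<Rightarrow> 'a list \<Rightarrow> int" where
  "chain_sign \<omega> xs = (\<Sum>i<length xs - 1. eps \<omega> (xs ! i) (xs ! Suc i))"

definition sign_graded_rank :: "'a set \<Rightarrow> ('a \<Rightarrow> 'a \<Rightarrow> bool) \<Rightarrow> ('a \<Rightarrow> nat) \<Rightarrow> int \<Rightarrow> bool" where
  "sign_graded_rank P le \<omega> r \<longleftrightarrow>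
     (\<forall>xs. maximal_chain P le xs \<longrightarrow> chain_sign \<omega> xs = r)"

definition linear_extension :: "'a set \<Rightarrow> ('a \<Rightarrow> 'a \<Rightarrow> bool) \<Rightarrow> 'a list \<Rightarrow> bool" where
  "linear_extension P le xs \<longleftrightarrow> distinct xs \<and> set xs = P \<and>
     (\<forall>i j. i < length xs \<and> j < length xs \<and> le (xs ! i) (xs ! j) \<longrightarrow> i \<le> j)"

definition des :: "nat list \<Rightarrow> nat" where
  "des \<pi> = card {i. Suc i < length \<pi> \<and> \<pi> ! i > \<pi> ! Suc i}"

definition Lperms :: "'a set \<Rightarrow> ('a \<Rightarrow> 'a \<Rightarrow> bool) \<Rightarrow> ('a \<Rightarrow> nat) \<Rightarrow> nat list set" where
  "Lperms P le \<omega> = map \<omega> ` {xs. linear_extension P le xs}"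

definition Wpoly :: "'a set \<Rightarrow> ('a \<Rightarrow> 'a \<Rightarrow> bool) \<Rightarrow> ('a \<Rightarrow> nat) \<Rightarrow> int poly" where
  "Wpoly P le \<omega> = (\<Sum>\<pi>\<in>Lperms P le \<omega>. monom 1 (des \<pi>))"

definition S_plus :: "nat \<Rightarrow> real poly set" where
  "S_plus d = {f. \<exists>a :: nat \<Rightarrow> real. (\<forall>i. a i \<ge> 0) \<and>
      f = (\<Sum>i\<le>d div 2. smult (a i) (monom 1 i * [:1, 1:] ^ (d - 2 * i)))}"

end

theory Submission
  imports Defs "HOL-Combinatorics.Multiset_Permutations"
begin

text \<open>Summing signs along saturated chains gives a rank function \<open>\<rho>\<close> that changes by one along every
  cover, is constant on the minimal and on the maximal elements, and determines the order of the
  labels along covers. The \<open>W\<close>-polynomial depends only on that order, so labels may be taken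
  to increase with \<open>\<rho>\<close>. Moving the elements of the largest rank \<open>m \<ge> 2\<close> down to rank \<open>m - 2\<close> amounts to
  moving the largest labels below all others; in a word, a block of such letters has an ascent before it and a
  descent after it, and the move exchanges the two. Hence \<open>W\<close> only changes by a factor \<open>t\<close> or \<open>1/t\<close>, which comes from
  the two ends of the words, and one may assume that \<open>\<rho>\<close> takes values in \<open>{0, 1}\<close>. Now an incomparable
  pair \<open>x, y\<close> with \<open>\<rho>(x) \<noteq> \<rho>(y)\<close> can be made comparable in both ways, which splits \<open>W\<close> into a sum and
  preserves all assumptions. If no such pair remains, the poset is an ordinal sum of antichains, and \<open>W\<close> is a power
  of \<open>t\<close> times a product of Eulerian polynomials.\<close>

section \<open>Arithmetic of the cones spanned by the polynomials t^i (1 + t)^(d - 2 i)\<close>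

lemma smult_sum: "smult c (sum f A) = (\<Sum>x\<in>A. smult c (f x))"
  by (induction A rule: infinite_finite_induct) (auto simp: smult_add_right)

lemma S_plus_gen:
  assumes "2 * i \<le> d"
  shows "monom 1 i * [:1, 1:] ^ (d - 2 * i) \<in> S_plus d"
proof -
  have "(\<Sum>j\<le>d div 2. smult (if j = i then 1 else 0) (monom 1 j * [:1, 1:] ^ (d - 2 * j)))
      = (\<Sum>j\<in>{i}. smult 1 (monom 1 j * [:1, 1:] ^ (d - 2 * j)) :: real poly)"
    by (rule sum.mono_neutral_cong_right) (use assms in auto)
  then show ?thesis
    unfolding S_plus_def mem_Collect_eq
    by (intro exI[of _ "\<lambda>j. if j = i then 1 else 0"]) simp
qed

lemma S_plus_zero: "0 \<in> S_plus d"
  unfolding S_plus_def by (auto intro!: exI[of _ "\<lambda>_. 0"])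

lemma S_plus_add:
  assumes "f \<in> S_plus d" "g \<in> S_plus d"
  shows "f + g \<in> S_plus d"
proof -
  obtain a b where "\<forall>i. a i \<ge> 0" "\<forall>i. b i \<ge> 0"
    and "f = (\<Sum>i\<le>d div 2. smult (a i) (monom 1 i * [:1, 1:] ^ (d - 2 * i)))"
    and "g = (\<Sum>i\<le>d div 2. smult (b i) (monom 1 i * [:1, 1:] ^ (d - 2 * i)))"
    using assms unfolding S_plus_def by blast
  then show ?thesis
    unfolding S_plus_def mem_Collect_eq
    by (intro exI[of _ "\<lambda>i. a i + b i"]) (simp add: smult_add_left sum.distrib)
qed

lemma S_plus_smult:
  assumes "f \<in> S_plus d" "c \<ge> 0"
  shows "smult c f \<in> S_plus d"
proof -
  obtain a where "\<forall>i. a i \<ge> 0"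
    and "f = (\<Sum>i\<le>d div 2. smult (a i) (monom 1 i * [:1, 1:] ^ (d - 2 * i)))"
    using assms unfolding S_plus_def by blast
  then show ?thesis
    using assms(2) unfolding S_plus_def mem_Collect_eq
    by (intro exI[of _ "\<lambda>i. c * a i"])
       (simp add: smult_sum)
qed

lemma S_plus_sum: "(\<And>x. x \<in> A \<Longrightarrow> f x \<in> S_plus d) \<Longrightarrow> sum f A \<in> S_plus d"
  by (induction A rule: infinite_finite_induct) (auto intro: S_plus_zero S_plus_add)

text \<open>Generators multiply to generators: the exponents of t add up, and so do those of 1 + t,
  because \<open>2 * i \<le> d\<close> and \<open>2 * j \<le> e\<close> keep the truncated
  subtractions exact.\<close>

lemma S_plus_mult:
  assumes "f \<in> S_plus d" "g \<in> S_plus e"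
  shows "f * g \<in> S_plus (d + e)"
proof -
  let ?G = "\<lambda>d i. monom 1 i * [:1, 1:] ^ (d - 2 * i) :: real poly"
  obtain a b where a: "\<forall>i. a i \<ge> 0" and b: "\<forall>i. b i \<ge> 0"
    and f: "f = (\<Sum>i\<le>d div 2. smult (a i) (?G d i))"
    and g: "g = (\<Sum>i\<le>e div 2. smult (b i) (?G e i))"
    using assms unfolding S_plus_def by blast
  have "?G d i * ?G e j \<in> S_plus (d + e)" if "i \<le> d div 2" "j \<le> e div 2" for i j
  proof -
    have "2 * i \<le> d" "2 * j \<le> e"
      using that by auto
    then have "d + e - 2 * (i + j) = (d - 2 * i) + (e - 2 * j)"
      by presburger
    then have "?G d i * ?G e j = ?G (d + e) (i + j)"
      using mult_monom[of "1::real" i 1 j] by (simp add: power_add mult_ac)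
    moreover have "2 * (i + j) \<le> d + e"
      using that by auto
    ultimately show ?thesis
      by (metis S_plus_gen)
  qed
  then have "(\<Sum>i\<le>d div 2. \<Sum>j\<le>e div 2. smult (a i * b j) (?G d i * ?G e j)) \<in> S_plus (d + e)"
    using a b by (intro S_plus_sum S_plus_smult) auto
  also have "(\<Sum>i\<le>d div 2. \<Sum>j\<le>e div 2. smult (a i * b j) (?G d i * ?G e j)) = f * g"
    unfolding f g sum_product by (simp add: ac_simps)
  finally show ?thesis .
qed

text \<open>Integer degrees keep the bookkeeping free of truncated subtraction. In negative degree only \<open>0\<close> is left.\<close>
definition S_plus_int :: "int \<Rightarrow> real poly set" where
  "S_plus_int d = {f. f = 0 \<or> d \<ge> 0 \<and> f \<in> S_plus (nat d)}"

lemma S_plus_int_subset: "S_plus_int d \<subseteq> S_plus (nat d)"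
  unfolding S_plus_int_def using S_plus_zero by blast

lemma S_plus_int_zero: "0 \<in> S_plus_int d"
  by (simp add: S_plus_int_def)

lemma S_plus_int_add: "f \<in> S_plus_int d \<Longrightarrow> g \<in> S_plus_int d \<Longrightarrow> f + g \<in> S_plus_int d"
  unfolding S_plus_int_def using S_plus_add by auto

lemma S_plus_int_sum: "(\<And>x. x \<in> A \<Longrightarrow> f x \<in> S_plus_int d) \<Longrightarrow> sum f A \<in> S_plus_int d"
  by (induction A rule: infinite_finite_induct) (auto intro: S_plus_int_zero S_plus_int_add)

lemma S_plus_int_mult:
  "f \<in> S_plus_int d \<Longrightarrow> g \<in> S_plus_int e \<Longrightarrow> f * g \<in> S_plus_int (d + e)"
  unfolding S_plus_int_def using S_plus_mult[of f "nat d" g "nat e"]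
  by (auto simp: nat_add_distrib)

lemma one_in_S_plus_int: "1 \<in> S_plus_int 0"
  using S_plus_gen[of 0 0] by (simp add: S_plus_int_def)

lemma monom_in_S_plus_int: "monom 1 k \<in> S_plus_int (2 * int k)"
  using S_plus_gen[of k "2 * k"] by (simp add: S_plus_int_def nat_mult_distrib)

lemma one_plus_in_S_plus_int: "[:1, 1:] \<in> S_plus_int 1"
  using S_plus_gen[of 0 1] by (simp add: S_plus_int_def)

text \<open>Only the generator with \<open>i = 0\<close> is not divisible by t. Once its coefficient
  is seen to vanish, t can be taken out of all the others; their powers of 1 + t stay the same, as
  \<open>e - 2 * Suc i = (e - 2) - 2 * i\<close>.\<close>

lemma S_plus_int_divide_monom:
  assumes "monom 1 1 * g \<in> S_plus_int d"
  shows "g \<in> S_plus_int (d - 2)"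
proof (cases "g = 0")
  case True
  then show ?thesis by (simp add: S_plus_int_zero)
next
  case False
  let ?G = "\<lambda>d i. monom 1 i * [:1, 1:] ^ (d - 2 * i) :: real poly"
  define e where "e = nat d"
  have d: "d = int e" and "monom 1 1 * g \<in> S_plus e"
    using assms False by (auto simp: S_plus_int_def e_def)
  then obtain a where a: "\<forall>i. a i \<ge> 0" and f: "monom 1 1 * g = (\<Sum>i\<le>e div 2. smult (a i) (?G e i))"
    unfolding S_plus_def by blast
  \<comment> \<open>Constant terms are compared: a generator has constant term 1 for
    \<open>i = 0\<close> and 0 otherwise.\<close>
  have "coeff (monom 1 1 * g) 0 = (\<Sum>i\<le>e div 2. if i = 0 then a i else 0)"
    unfolding f coeff_sum
    by (rule sum.cong) (auto simp: coeff_monom_mult coeff_0_power simp flip: One_nat_def)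
  then have a0: "a 0 = 0"
    by (simp add: coeff_monom_mult)
  \<comment> \<open>For \<open>e div 2 = 0\<close> the whole sum would be the term of
    \<open>a 0 = 0\<close>, against \<open>g \<noteq> 0\<close>.\<close>
  have e: "e div 2 = Suc ((e - 2) div 2) \<and> 2 \<le> e"
  proof (rule ccontr)
    assume "\<not> ?thesis"
    then have "e div 2 = 0" by auto
    then show False using f a0 False by simp
  qed
  have "monom 1 1 * g = (\<Sum>i\<le>(e - 2) div 2. smult (a (Suc i)) (?G e (Suc i)))"
    using a0 unfolding f conjunct1[OF e] by (subst sum.atMost_Suc_shift) simp
  also have "\<dots> = monom 1 1 * (\<Sum>i\<le>(e - 2) div 2. smult (a (Suc i)) (?G (e - 2) i))"
    unfolding sum_distrib_left
    by (rule sum.cong) (auto simp: mult_monom simp flip: mult.assoc)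
  finally have "g = (\<Sum>i\<le>(e - 2) div 2. smult (a (Suc i)) (?G (e - 2) i))"
    by simp
  moreover have "nat (d - 2) = e - 2" using e d by auto
  ultimately show ?thesis
    unfolding S_plus_int_def S_plus_def using e d a by auto
qed

section \<open>Descents of words and Eulerian polynomials\<close>

lemma des_simps [simp]:
  "des [] = 0" "des [x] = 0"
  "des (x # y # zs) = of_bool (x > y) + des (y # zs)"
proof -
  let ?A = "{i. Suc i < length (y # zs) \<and> (y # zs) ! i > (y # zs) ! Suc i}"
  have "{i. Suc i < length (x # y # zs) \<and> (x # y # zs) ! i > (x # y # zs) ! Suc i}
      = (if x > y then {0} else {}) \<union> Suc ` ?A" (is "?B = _")
  proof (rule set_eqI)
    fix i show "i \<in> ?B \<longleftrightarrow> i \<in> (if x > y then {0} else {}) \<union> Suc ` ?A"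
      by (cases i) (auto simp: image_iff)
  qed
  moreover have "card (Suc ` ?A) = card ?A"
    by (rule card_image) simp
  moreover have "finite ?A" by simp
  ultimately show "des (x # y # zs) = of_bool (x > y) + des (y # zs)"
    unfolding des_def by (auto simp: card_insert_if)
qed (auto simp: des_def)

lemma des_append:
  assumes "xs \<noteq> []" "ys \<noteq> []"
  shows "des (xs @ ys) = des xs + of_bool (last xs > hd ys) + des ys"
  using assms
proof (induction xs rule: induct_list012)
  case (2 x)
  then show ?case by (cases ys) auto
qed auto

lemma takeWhile_neq_append: "m \<notin> set us \<Longrightarrow> takeWhile (\<lambda>x. x \<noteq> m) (us @ m # vs) = us"
  by (induction us) auto

lemma dropWhile_neq_append: "m \<notin> set us \<Longrightarrow> dropWhile (\<lambda>x. x \<noteq> m) (us @ m # vs) = m # vs"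
  by (induction us) auto

text \<open>Splitting a permutation at its largest letter pairs the summands \<open>A\<close> and \<open>t A\<close> that
  come from the two extreme positions into \<open>(1 + t) A\<close>; all other summands are products.\<close>
lemma Eulerian_in_S_plus_int:
  assumes "finite M" "M \<noteq> {}" "inj_on \<omega> M"
  shows "(\<Sum>xs\<in>permutations_of_set M. monom 1 (des (map \<omega> xs))) \<in> S_plus_int (int (card M) - 1)"
  using assms
proof (induction "card M" arbitrary: M rule: less_induct)
  case less
  let ?E = "\<lambda>M. \<Sum>xs\<in>permutations_of_set M. monom 1 (des (map \<omega> xs)) :: real poly"
  have "Max (\<omega> ` M) \<in> \<omega> ` M"
    using less.prems(1,2) by simp
  then obtain m where m: "m \<in> M" and "\<omega> m = Max (\<omega> ` M)"
    by auto
  then have max: "\<omega> x \<le> \<omega> m" if "x \<in> M" for x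
    using that less.prems(1) by simp
  define B where "B = M - {m}"
  have fB: "finite B" and mB: "m \<notin> B" "M = insert m B"
    using m less.prems(1) by (auto simp: B_def)
  have card: "card M = Suc (card B)"
    using fB mB by simp
  have lt: "\<omega> x < \<omega> m" if "x \<in> B" for x
    using that m max[of x] inj_onD[OF less.prems(3), of x m] by (auto simp: B_def less_le)
  \<comment> \<open>\<open>A\<close> is the set of letters to the left of \<open>m\<close>;
    \<open>us\<close> and \<open>vs\<close> are the words on its two sides.\<close>
  let ?S = "SIGMA A:Pow B. permutations_of_set A \<times> permutations_of_set (B - A)"
  have "?E M = (\<Sum>(A, us, vs)\<in>?S. monom 1 (des (map \<omega> (us @ m # vs))))"
  proof (rule sum.reindex_bij_witness[where i = "\<lambda>(A, us, vs). us @ m # vs" and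
        j = "\<lambda>xs. (set (takeWhile (\<lambda>x. x \<noteq> m) xs), takeWhile (\<lambda>x. x \<noteq> m) xs, tl (dropWhile (\<lambda>x. x \<noteq> m) xs))"])
    fix xs assume xs: "xs \<in> permutations_of_set M"
    then have "m \<in> set xs" using m by (auto simp: permutations_of_set_def)
    then obtain us vs where split: "xs = us @ m # vs" "m \<notin> set us"
      by (metis split_list_first)
    then have tw: "takeWhile (\<lambda>x. x \<noteq> m) xs = us" "dropWhile (\<lambda>x. x \<noteq> m) xs = m # vs"
      using split by (simp_all add: takeWhile_neq_append dropWhile_neq_append)
    have perm: "set us \<union> set vs = B" "set us \<inter> set vs = {}" "distinct us" "distinct vs"
      using xs mB unfolding split(1) permutations_of_set_def by auto
    show "(\<lambda>(A, us, vs). us @ m # vs) (set (takeWhile (\<lambda>x. x \<noteq> m) xs), takeWhile (\<lambda>x. x \<noteq> m) xs, tl (dropWhile (\<lambda>x. x \<noteq> m) xs)) = xs"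
      using tw split by simp
    show "(set (takeWhile (\<lambda>x. x \<noteq> m) xs), takeWhile (\<lambda>x. x \<noteq> m) xs, tl (dropWhile (\<lambda>x. x \<noteq> m) xs)) \<in> ?S"
      using xs perm unfolding tw by (auto simp: permutations_of_set_def)
    show "(case (set (takeWhile (\<lambda>x. x \<noteq> m) xs), takeWhile (\<lambda>x. x \<noteq> m) xs, tl (dropWhile (\<lambda>x. x \<noteq> m) xs)) of
       (A, us, vs) \<Rightarrow> monom 1 (des (map \<omega> (us @ m # vs)))) = monom 1 (des (map \<omega> xs))"
      using tw split by simp
  next
    fix z assume z: "z \<in> ?S"
    then obtain A us vs where zz: "z = (A, us, vs)" "A \<subseteq> B" "set us = A" "distinct us"
      "set vs = B - A" "distinct vs"
      by (auto simp: permutations_of_set_def)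
    then have "m \<notin> set us" using mB by auto
    then have tw: "takeWhile (\<lambda>x. x \<noteq> m) (us @ m # vs) = us" "dropWhile (\<lambda>x. x \<noteq> m) (us @ m # vs) = m # vs"
      by (simp_all add: takeWhile_neq_append dropWhile_neq_append)
    show "(\<lambda>xs. (set (takeWhile (\<lambda>x. x \<noteq> m) xs), takeWhile (\<lambda>x. x \<noteq> m) xs, tl (dropWhile (\<lambda>x. x \<noteq> m) xs)))
         ((\<lambda>(A, us, vs). us @ m # vs) z) = z"
      using zz tw by simp
    show "(\<lambda>(A, us, vs). us @ m # vs) z \<in> permutations_of_set M"
      using zz mB by (auto simp: permutations_of_set_def)
  qed
  also have "\<dots> = (\<Sum>A\<in>Pow B. \<Sum>us\<in>permutations_of_set A. \<Sum>vs\<in>permutations_of_set (B - A).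
        monom 1 (des (map \<omega> (us @ m # vs))))"
    using fB by (simp add: sum.Sigma finite_subset)
  \<comment> \<open>No descent leads into the largest letter, and one leads out of it unless it
    comes last, that is, unless \<open>A = B\<close>.\<close>
  also have "\<dots> = (\<Sum>A\<in>Pow B. ?E A * ?E (B - A) * monom 1 (of_bool (A \<noteq> B)))"
  proof (rule sum.cong[OF refl])
    fix A assume A: "A \<in> Pow B"
    have "monom 1 (des (map \<omega> (us @ m # vs))) =
        monom 1 (des (map \<omega> us)) * monom 1 (des (map \<omega> vs)) * monom (1::real) (of_bool (A \<noteq> B))"
      if us: "us \<in> permutations_of_set A" and vs: "vs \<in> permutations_of_set (B - A)" for us vs
    proof -
      have "des (map \<omega> (us @ [m])) = des (map \<omega> us)"
      proof (cases "us = []")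
        case False
        then have "last us \<in> B" using us A by (auto simp: permutations_of_set_def)
        then show ?thesis using False lt[of "last us"] by (simp add: des_append last_map)
      qed simp
      moreover have "vs \<noteq> [] \<longleftrightarrow> A \<noteq> B" using vs A by (auto simp: permutations_of_set_def)
      moreover have "vs \<noteq> [] \<Longrightarrow> hd vs \<in> B" using vs by (auto simp: permutations_of_set_def)
      ultimately have "des (map \<omega> ((us @ [m]) @ vs)) = des (map \<omega> us) + des (map \<omega> vs) + of_bool (A \<noteq> B)"
        using lt[of "hd vs"] des_append[of "map \<omega> (us @ [m])" "map \<omega> vs"]
        by (cases "vs = []") (auto simp: hd_map)
      then show ?thesis by (simp add: mult_monom)
    qed
    then have "(\<Sum>us\<in>permutations_of_set A. \<Sum>vs\<in>permutations_of_set (B - A).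
        monom 1 (des (map \<omega> (us @ m # vs)))) = (\<Sum>us\<in>permutations_of_set A. \<Sum>vs\<in>permutations_of_set (B - A).
        monom 1 (des (map \<omega> us)) * monom 1 (des (map \<omega> vs)) * monom (1::real) (of_bool (A \<noteq> B)))"
      by (intro sum.cong refl)
    also have "\<dots> = ?E A * ?E (B - A) * monom 1 (of_bool (A \<noteq> B))"
      by (subst sum_product) (simp only: sum_distrib_right)
    finally show "(\<Sum>us\<in>permutations_of_set A. \<Sum>vs\<in>permutations_of_set (B - A).
        monom 1 (des (map \<omega> (us @ m # vs)))) = ?E A * ?E (B - A) * monom 1 (of_bool (A \<noteq> B))" .
  qed
  finally have E: "?E M = (\<Sum>A\<in>Pow B. ?E A * ?E (B - A) * monom 1 (of_bool (A \<noteq> B)))" .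
  have injB: "inj_on \<omega> A" if "A \<subseteq> B" for A
    using less.prems(3) that mB(2) by (meson inj_on_subset subset_insertI2)
  show ?case
  proof (cases "B = {}")
    case True
    then show ?thesis using E card one_in_S_plus_int by (simp add: monom_0 one_pCons)
  next
    case False
    have IH: "?E A \<in> S_plus_int (int (card A) - 1)" if "A \<subseteq> B" "A \<noteq> {}" for A
      using less.hyps[of A] that injB card card_mono[OF fB that(1)] finite_subset[OF that(1) fB] by auto
    have "Pow B - {{}} - {B} = Pow B - {{}, B}" by auto
    then have "sum g (Pow B) = g {} + (g B + sum g (Pow B - {{}, B}))" for g :: "'a set \<Rightarrow> real poly"
      using sum.remove[of "Pow B" "{}" g] sum.remove[of "Pow B - {{}}" B g] False fB by simp
    then have "?E M = ?E {} * ?E (B - {}) * monom 1 (of_bool ({} \<noteq> B)) +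
       (?E B * ?E (B - B) * monom 1 (of_bool (B \<noteq> B)) +
       (\<Sum>A\<in>Pow B - {{}, B}. ?E A * ?E (B - A) * monom 1 (of_bool (A \<noteq> B))))"
      unfolding E .
    also have "\<dots> = [:1, 1:] * ?E B + (\<Sum>A\<in>Pow B - {{}, B}. ?E A * ?E (B - A) * monom 1 (of_bool (A \<noteq> B)))"
    proof -
      have "[:1, 1:] = 1 + monom (1::real) 1" by (simp add: monom_altdef one_pCons)
      then show ?thesis using False by (simp add: algebra_simps monom_0 one_pCons)
    qed
    also have "\<dots> \<in> S_plus_int (int (card M) - 1)"
    proof (rule S_plus_int_add)
      show "[:1, 1:] * ?E B \<in> S_plus_int (int (card M) - 1)"
        using S_plus_int_mult[OF one_plus_in_S_plus_int IH[of B]] False card by simp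
      show "(\<Sum>A\<in>Pow B - {{}, B}. ?E A * ?E (B - A) * monom 1 (of_bool (A \<noteq> B)))
           \<in> S_plus_int (int (card M) - 1)"
      proof (rule S_plus_int_sum)
        fix A assume A: "A \<in> Pow B - {{}, B}"
        then have "int (card B) = int (card A) + int (card (B - A))"
          using fB by (metis DiffD1 PowD card_Diff_subset card_mono finite_subset le_add_diff_inverse of_nat_add)
        \<comment> \<open>The two factors have degrees adding up to \<open>card B - 2\<close>, and t
          counts as degree 2, which gives \<open>card B = card M - 1\<close>.\<close>
        moreover have "?E A * ?E (B - A) * monom 1 1 \<in>
          S_plus_int (int (card A) - 1 + (int (card (B - A)) - 1) + 2 * int 1)"
          using A by (intro S_plus_int_mult IH monom_in_S_plus_int) auto
        ultimately show "?E A * ?E (B - A) * monom 1 (of_bool (A \<noteq> B)) \<in> S_plus_int (int (card M) - 1)"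
          using A card by simp
      qed
    qed
    finally show ?thesis .
  qed
qed

section \<open>The W-polynomial as a sum over linear extensions; existence of covers\<close>

text \<open>The sum runs over extensions instead of words and allows arbitrary natural labels, so
  that order and labels can be changed independently. Coefficients are real to match
  \<open>S_plus\<close>.\<close>

definition W_labeling :: "'a set \<Rightarrow> ('a \<Rightarrow> 'a \<Rightarrow> bool) \<Rightarrow> ('a \<Rightarrow> nat) \<Rightarrow> real poly" where
  "W_labeling P le \<omega> = (\<Sum>xs | linear_extension P le xs. monom 1 (des (map \<omega> xs)))"

definition minimal_in :: "'a set \<Rightarrow> ('a \<Rightarrow> 'a \<Rightarrow> bool) \<Rightarrow> 'a \<Rightarrow> bool" where
  "minimal_in P le x \<longleftrightarrow> x \<in> P \<and> (\<forall>z\<in>P. le z x \<longrightarrow> z = x)"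

definition maximal_in :: "'a set \<Rightarrow> ('a \<Rightarrow> 'a \<Rightarrow> bool) \<Rightarrow> 'a \<Rightarrow> bool" where
  "maximal_in P le x \<longleftrightarrow> x \<in> P \<and> (\<forall>z\<in>P. le x z \<longrightarrow> z = x)"

lemma finite_linear_extensions: "finite P \<Longrightarrow> finite {xs. linear_extension P le xs}"
  by (rule finite_subset[OF _ finite_permutations_of_set[of P]])
     (auto simp: linear_extension_def permutations_of_set_def)

lemma Wpoly_eq_W_labeling:
  assumes "inj_on \<omega> P"
  shows "map_poly of_int (Wpoly P le \<omega>) = W_labeling P le \<omega>"
proof -
  let ?L = "{xs. linear_extension P le xs}"
  have "inj_on (map \<omega>) ?L"
    using assms by (intro inj_onI) (auto simp: linear_extension_def intro: map_inj_on)
  then have "Wpoly P le \<omega> = (\<Sum>xs\<in>?L. monom 1 (des (map \<omega> xs)))"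
    unfolding Wpoly_def Lperms_def by (simp add: sum.reindex)
  then show ?thesis
    by (intro poly_eqI) (auto simp: W_labeling_def coeff_map_poly coeff_sum intro!: sum.cong)
qed

text \<open>Contraposition of the condition on indices. In this form the rules for
  \<open>sorted_wrt\<close> on appended and filtered lists apply.\<close>

lemma linear_extension_iff_sorted_wrt:
  assumes "partial_order_on' P le"
  shows "linear_extension P le xs \<longleftrightarrow>
    distinct xs \<and> set xs = P \<and> sorted_wrt (\<lambda>x y. \<not> le y x) xs"
proof -
  have "(\<forall>i j. i < length xs \<and> j < length xs \<and> le (xs ! i) (xs ! j) \<longrightarrow> i \<le> j) \<longleftrightarrow>
      (\<forall>i j. i < j \<longrightarrow> j < length xs \<longrightarrow> \<not> le (xs ! j) (xs ! i))"
    by (meson leD le_less_linear less_trans)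
  then show ?thesis
    unfolding linear_extension_def sorted_wrt_iff_nth_less by blast
qed

lemma linear_extension_appendD:
  assumes "partial_order_on' P le" "linear_extension P le (us @ vs)" "x \<in> set us" "y \<in> set vs"
  shows "\<not> le y x"
  using assms by (auto simp: linear_extension_iff_sorted_wrt sorted_wrt_append)

lemma hd_linear_extension_minimal:
  assumes "partial_order_on' P le" "linear_extension P le xs" "xs \<noteq> []"
  shows "minimal_in P le (hd xs)"
  using assms by (cases xs) (auto simp: linear_extension_iff_sorted_wrt minimal_in_def)

lemma last_linear_extension_maximal:
  assumes "partial_order_on' P le" "linear_extension P le xs" "xs \<noteq> []"
  shows "maximal_in P le (last xs)"
  using assms
  by (cases xs rule: rev_cases) (auto simp: linear_extension_iff_sorted_wrt sorted_wrt_append maximal_in_def)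

text \<open>Induction on the size of the interval from \<open>x\<close> to \<open>y\<close>: if
  \<open>y\<close> does not cover \<open>x\<close>, an element strictly between them is the top of a
  smaller interval with the same bottom \<open>x\<close>.\<close>

lemma exists_cover_above:
  assumes "finite P" "partial_order_on' P le" "x \<in> P" "y \<in> P" "le x y" "x \<noteq> y"
  shows "\<exists>c. covers P le x c \<and> le c y"
  using assms(4-)
proof (induction "card {z \<in> P. le x z \<and> le z y}" arbitrary: y rule: less_induct)
  case less
  have po: "\<And>u v w. u \<in> P \<Longrightarrow> v \<in> P \<Longrightarrow> w \<in> P \<Longrightarrow> le u v \<Longrightarrow> le v w \<Longrightarrow> le u w"
     "\<And>u v. u \<in> P \<Longrightarrow> v \<in> P \<Longrightarrow> le u v \<Longrightarrow> le v u \<Longrightarrow> u = v" "\<And>u. u \<in> P \<Longrightarrow> le u u"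
    using assms(2) unfolding partial_order_on'_def by blast+
  show ?case
  proof (cases "covers P le x y")
    case True
    then show ?thesis using po(3)[of y] less.prems(1) by auto
  next
    case False
    then obtain z where z: "z \<in> P" "le x z" "le z y" "z \<noteq> x" "z \<noteq> y"
      using less.prems assms(3) by (auto simp: covers_def)
    have "{w \<in> P. le x w \<and> le w z} \<subseteq> {w \<in> P. le x w \<and> le w y}"
      using z less.prems(1) po(1)[of _ z y] by auto
    moreover have "y \<notin> {w \<in> P. le x w \<and> le w z}" "y \<in> {w \<in> P. le x w \<and> le w y}"
      using z less.prems po(2)[of y z] po(3)[of y] by auto
    ultimately have "{w \<in> P. le x w \<and> le w z} \<subset> {w \<in> P. le x w \<and> le w y}"
      by blast
    then have "card {w \<in> P. le x w \<and> le w z} < card {w \<in> P. le x w \<and> le w y}"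
      using assms(1) by (intro psubset_card_mono) auto
    then obtain c where "covers P le x c" "le c z"
      using less.hyps[of z] z by auto
    then show ?thesis using po(1)[of c z y] z less.prems by (auto simp: covers_def)
  qed
qed

lemma partial_order_on'_converse:
  assumes "partial_order_on' P le"
  shows "partial_order_on' P (\<lambda>x y. le y x)"
  unfolding partial_order_on'_def
proof (intro conjI ballI impI)
  fix x y z assume "x \<in> P" "y \<in> P" "z \<in> P" "le y x \<and> le z y"
  then show "le z x" using assms unfolding partial_order_on'_def by meson
next
  fix x y assume "x \<in> P" "y \<in> P" "le y x \<and> le x y"
  then show "x = y" using assms unfolding partial_order_on'_def by meson
qed (use assms in \<open>simp add: partial_order_on'_def\<close>)

lemma covers_converse: "covers P (\<lambda>x y. le y x) x y \<longleftrightarrow> covers P le y x"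
  unfolding covers_def by meson

lemma exists_cover_below:
  assumes "finite P" "partial_order_on' P le" "x \<in> P" "y \<in> P" "le x y" "x \<noteq> y"
  shows "\<exists>c. covers P le c y \<and> le x c"
  using exists_cover_above[OF assms(1) partial_order_on'_converse[OF assms(2)], of y x] assms(3-)
  unfolding covers_converse[of P le] by auto

section \<open>How the W-polynomial depends on the labels\<close>

lemma des_map_cong:
  assumes "successively (\<lambda>u v. \<mu> u > \<mu> v \<longleftrightarrow> \<omega> u > \<omega> v) xs"
  shows "des (map \<mu> xs) = des (map \<omega> xs)"
  using assms by (induction xs rule: induct_list012) auto

text \<open>Exchange the labels of \<open>x\<close> and \<open>y\<close>, which are consecutive in the order of labels: only
  words in which \<open>x\<close> and \<open>y\<close> are neighbours notice, and there the two letters can be exchanged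
  as well since they are incomparable.\<close>
lemma W_labeling_swap:
  assumes fin: "finite P" and po: "partial_order_on' P le" and inj: "inj_on \<omega> P"
    and x: "x \<in> P" and y: "y \<in> P" and xy: "\<omega> x < \<omega> y"
    and adj: "\<And>z. z \<in> P \<Longrightarrow> \<omega> z \<le> \<omega> x \<or> \<omega> y \<le> \<omega> z"
    and nc: "\<not> covers P le x y" "\<not> covers P le y x"
  shows "W_labeling P le (\<omega>(x := \<omega> y, y := \<omega> x)) = W_labeling P le \<omega>"
proof -
  let ?\<mu> = "\<omega>(x := \<omega> y, y := \<omega> x)" and ?L = "{xs. linear_extension P le xs}"
  have ne: "x \<noteq> y" using xy by auto
  define nbr where "nbr xs \<longleftrightarrow> (\<exists>us u v vs. xs = us @ u # v # vs \<and> (u, v) \<in> {(x, y), (y, x)})" for xs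
  define \<phi> where "\<phi> xs = (if nbr xs then map (transpose x y) xs else xs)" for xs
  \<comment> \<open>Transposing the letters undoes the exchange of labels, so wherever
    \<open>\<phi>\<close> transposes, the word of labels is preserved.\<close>
  have \<mu>: "?\<mu> (transpose x y z) = \<omega> z" for z
    using ne by (auto simp: transpose_def)
  have unaffected: "map (transpose x y) us = us" if "x \<notin> set us" "y \<notin> set us" for us
    using that by (induction us) (auto simp: transpose_def)
  have nbr_\<phi>: "nbr (\<phi> xs) \<longleftrightarrow> nbr xs" for xs
  proof -
    have "nbr (map (transpose x y) xs)" if nb: "nbr xs" for xs
    proof -
      obtain us u v vs where "xs = us @ u # v # vs" "(u, v) \<in> {(x, y), (y, x)}"
        using nb unfolding nbr_def by metis
      then have "map (transpose x y) xs = map (transpose x y) us @ v # u # map (transpose x y) vs"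
          "(v, u) \<in> {(x, y), (y, x)}"
        by auto
      then show ?thesis unfolding nbr_def by metis
    qed
    then show ?thesis unfolding \<phi>_def by auto
  qed
  have \<phi>\<phi>: "\<phi> (\<phi> xs) = xs" for xs
    using nbr_\<phi>[of xs] by (auto simp: \<phi>_def comp_def)
  have swap: "linear_extension P le (us @ v # u # vs) \<and> map (transpose x y) (us @ u # v # vs) = us @ v # u # vs"
    if "linear_extension P le (us @ u # v # vs)" "(u, v) \<in> {(x, y), (y, x)}" for us u v vs
  proof -
    have uv: "u \<in> P" "v \<in> P" and d: "distinct (us @ u # v # vs)" "set (us @ u # v # vs) = P"
      using that x y by (auto simp: linear_extension_def)
    have "\<not> le u v"
    proof
      assume le: "le u v"
      \<comment> \<open>Any other letter stands before \<open>u\<close> or after \<open>v\<close> in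
        the extension, so it cannot lie between them in the order; \<open>le u v\<close> would
        therefore be a cover.\<close>
      have "\<not> (le u z \<and> le z v)" if z: "z \<in> P" "z \<noteq> u" "z \<noteq> v" for z
      proof -
        have "z \<in> set us \<or> z \<in> set vs" using z d by auto
        then show ?thesis
          using linear_extension_appendD[OF po, of us "u # v # vs" z u]
            linear_extension_appendD[OF po, of "us @ [u, v]" vs v z] that(1)
            \<open>linear_extension P le (us @ u # v # vs)\<close> by auto
      qed
      then have "covers P le u v" using le uv d by (auto simp: covers_def)
      then show False using nc that(2) by auto
    qed
    then have "linear_extension P le (us @ v # u # vs)"
      using that(1) by (auto simp: linear_extension_iff_sorted_wrt[OF po] sorted_wrt_append)
    moreover have "x \<notin> set us" "y \<notin> set us" "x \<notin> set vs" "y \<notin> set vs"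
      using d that(2) by auto
    ultimately show ?thesis using that(2) by (auto simp: unaffected)
  qed
  have \<phi>_lin: "linear_extension P le (\<phi> xs)" if lin: "linear_extension P le xs" for xs
  proof (cases "nbr xs")
    case True
    then obtain us u v vs where "xs = us @ u # v # vs" "(u, v) \<in> {(x, y), (y, x)}"
      unfolding nbr_def by metis
    then show ?thesis using swap[of us u v vs] lin True by (simp add: \<phi>_def)
  next
    case False
    then show ?thesis using lin by (simp add: \<phi>_def)
  qed
  have des: "des (map ?\<mu> (\<phi> xs)) = des (map \<omega> xs)" if lin: "linear_extension P le xs" for xs
  proof (cases "nbr xs")
    case True
    then show ?thesis by (simp only: \<phi>_def if_True map_map) (simp add: comp_def \<mu> del: fun_upd_apply)
  next
    case False
    \<comment> \<open>Of two neighbouring letters at most one is now \<open>x\<close> or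
      \<open>y\<close>. The label of the other is not between those of \<open>x\<close> and
      \<open>y\<close>, so the comparison is the same under both labelings.\<close>
    have "successively (\<lambda>u v. ?\<mu> u > ?\<mu> v \<longleftrightarrow> \<omega> u > \<omega> v) xs"
      unfolding successively_conv_nth
    proof (intro allI impI)
      fix i assume i: "Suc i < length xs"
      let ?u = "xs ! i" and ?v = "xs ! Suc i"
      have split: "xs = take i xs @ ?u # ?v # drop (Suc (Suc i)) xs"
        using i by (simp add: Cons_nth_drop_Suc)
      then have "(?u, ?v) \<notin> {(x, y), (y, x)}"
        using False unfolding nbr_def by metis
      then have "(?u, ?v) \<noteq> (x, y)" "(?u, ?v) \<noteq> (y, x)"
        by auto
      moreover have uv: "?u \<in> P" "?v \<in> P" "?u \<noteq> ?v"
        using lin i nth_eq_iff_index_eq[of xs i "Suc i"] by (auto simp: linear_extension_def)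
      moreover have "\<omega> ?u \<noteq> \<omega> ?v" "?u \<noteq> x \<Longrightarrow> \<omega> ?u \<noteq> \<omega> x" "?v \<noteq> x \<Longrightarrow> \<omega> ?v \<noteq> \<omega> x"
          "?u \<noteq> y \<Longrightarrow> \<omega> ?u \<noteq> \<omega> y" "?v \<noteq> y \<Longrightarrow> \<omega> ?v \<noteq> \<omega> y"
        using inj uv x y by (auto simp: inj_on_eq_iff)
      ultimately show "?\<mu> ?u > ?\<mu> ?v \<longleftrightarrow> \<omega> ?u > \<omega> ?v"
        using adj[of ?u] adj[of ?v] xy by auto
    qed
    then show ?thesis using False by (simp add: \<phi>_def des_map_cong)
  qed
  show ?thesis
    unfolding W_labeling_def
  proof (rule sum.reindex_bij_witness[where i = \<phi> and j = \<phi>])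
    fix xs assume "xs \<in> ?L"
    then show "monom (1::real) (des (map \<omega> (\<phi> xs))) = monom 1 (des (map ?\<mu> xs))"
      using des[OF \<phi>_lin, of xs] \<phi>\<phi>[of xs] by (simp del: fun_upd_apply)
  qed (use \<phi>\<phi> \<phi>_lin in simp_all)
qed

text \<open>Bubble sort: induction on the number of pairs that \<open>\<omega>\<close> and
  \<open>\<nu>\<close> order oppositely. Such a pair with the least difference of
  \<open>\<omega>\<close>-labels is not a cover and has consecutive labels, so its labels can be
  exchanged without changing \<open>W_labeling\<close>; this removes one inversion and creates
  none.\<close>

lemma W_labeling_cong_covers:
  assumes fin: "finite P" and po: "partial_order_on' P le" and inj: "inj_on \<omega> P" "inj_on \<nu> P"
    and cov: "\<And>x y. covers P le x y \<Longrightarrow> \<omega> x < \<omega> y \<longleftrightarrow> \<nu> x < \<nu> y"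
  shows "W_labeling P le \<omega> = W_labeling P le \<nu>"
  using inj(1) cov
proof (induction "card {(u, v) \<in> P \<times> P. \<omega> u < \<omega> v \<and> \<nu> v < \<nu> u}" arbitrary: \<omega> rule: less_induct)
  case less
  let ?I = "\<lambda>\<omega>. {(u, v) \<in> P \<times> P. \<omega> u < \<omega> v \<and> \<nu> v < \<nu> u}"
  show ?case
  proof (cases "?I \<omega> = {}")
    case True
    have "\<omega> u < \<omega> v \<longleftrightarrow> \<nu> u < \<nu> v" if "u \<in> P" "v \<in> P" for u v
      using that True less.prems(1) inj(2) unfolding inj_on_def
      by (smt (verit, best) case_prodI empty_iff linorder_neqE_nat mem_Collect_eq mem_Sigma_iff order.asym)
    then have "des (map \<omega> xs) = des (map \<nu> xs)" if "linear_extension P le xs" for xs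
      using that by (intro des_map_cong) (auto simp: successively_conv_nth linear_extension_def)
    then show ?thesis unfolding W_labeling_def by (intro sum.cong) auto
  next
    case False
    then obtain x y where xy: "(x, y) \<in> ?I \<omega>" and
      min: "\<And>u v. (u, v) \<in> ?I \<omega> \<Longrightarrow> \<omega> y - \<omega> x \<le> \<omega> v - \<omega> u"
      using ex_has_least_nat[of "\<lambda>p. p \<in> ?I \<omega>" _ "\<lambda>(u, v). \<omega> v - \<omega> u"] by fast
    have mem: "x \<in> P" "y \<in> P" "\<omega> x < \<omega> y" "\<nu> y < \<nu> x" using xy by auto
    \<comment> \<open>If the label of \<open>z\<close> were strictly between, \<open>(x, z)\<close>
      or \<open>(z, y)\<close> would be an inversion with a smaller difference.\<close>
    have adj: "\<omega> z \<le> \<omega> x \<or> \<omega> y \<le> \<omega> z" if "z \<in> P" for z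
      using min[of x z] min[of z y] that mem by fastforce
    have nc: "\<not> covers P le x y" "\<not> covers P le y x"
      using less.prems(2)[of x y] less.prems(2)[of y x] mem by auto
    let ?\<mu> = "\<omega>(x := \<omega> y, y := \<omega> x)"
    have inj\<omega>: "\<And>u v. u \<in> P \<Longrightarrow> v \<in> P \<Longrightarrow> \<omega> u = \<omega> v \<longleftrightarrow> u = v"
      using less.prems(1) by (auto simp: inj_on_eq_iff)
    have same: "?\<mu> u < ?\<mu> v \<longleftrightarrow> \<omega> u < \<omega> v" if "u \<in> P" "v \<in> P" "(u, v) \<noteq> (x, y)" "(u, v) \<noteq> (y, x)" for u v
      using that mem adj[of u] adj[of v] inj\<omega>[of u v] inj\<omega>[of u x] inj\<omega>[of u y] inj\<omega>[of v x] inj\<omega>[of v y]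
      by auto
    have "?I ?\<mu> \<subseteq> ?I \<omega> - {(x, y)}"
      using same mem by (auto split: if_splits simp del: fun_upd_apply; metis fun_upd_other fun_upd_same less_asym)
    then have "?I ?\<mu> \<subset> ?I \<omega>" using xy by blast
    then have "card (?I ?\<mu>) < card (?I \<omega>)"
      using fin by (intro psubset_card_mono) (auto intro: finite_subset[of _ "P \<times> P"])
    moreover have "inj_on ?\<mu> P"
      using inj\<omega> mem by (auto simp: inj_on_def)
    moreover have "?\<mu> u < ?\<mu> v \<longleftrightarrow> \<nu> u < \<nu> v" if "covers P le u v" for u v
      using same[of u v] less.prems(2)[OF that] nc that by (metis covers_def prod.inject)
    ultimately have "W_labeling P le ?\<mu> = W_labeling P le \<nu>"
      by (intro less.hyps)
    then show ?thesis
      using W_labeling_swap[OF fin po less.prems(1) mem(1-3) adj nc] by simp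
  qed
qed

text \<open>The letters in \<open>S\<close> carry the largest labels under \<open>\<omega>\<close> and the smallest under \<open>\<mu>\<close>.\<close>
lemma des_flip:
  assumes "xs \<noteq> []"
    and "\<And>u v. u \<in> set xs \<Longrightarrow> v \<in> set xs \<Longrightarrow> (u \<in> S \<longleftrightarrow> v \<in> S) \<Longrightarrow> \<omega> u > \<omega> v \<longleftrightarrow> \<mu> u > \<mu> v"
    and "\<And>u v. u \<in> set xs \<Longrightarrow> v \<in> set xs \<Longrightarrow> u \<in> S \<Longrightarrow> v \<notin> S \<Longrightarrow> \<omega> u > \<omega> v \<and> \<mu> u < \<mu> v"
  shows "des (map \<omega> xs) + of_bool (last xs \<in> S) = des (map \<mu> xs) + of_bool (hd xs \<in> S)"
  using assms
proof (induction xs rule: induct_list012)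
  case (3 x y zs)
  have "des (map \<omega> (y # zs)) + of_bool (last (y # zs) \<in> S) = des (map \<mu> (y # zs)) + of_bool (hd (y # zs) \<in> S)"
    using 3 by (intro "3.IH"(2)) auto
  moreover have "(x \<in> S \<longleftrightarrow> y \<in> S) \<Longrightarrow> \<omega> x > \<omega> y \<longleftrightarrow> \<mu> x > \<mu> y"
    using 3(4)[of x y] by simp
  moreover have "x \<in> S \<Longrightarrow> y \<notin> S \<Longrightarrow> \<omega> x > \<omega> y \<and> \<mu> x < \<mu> y" "x \<notin> S \<Longrightarrow> y \<in> S \<Longrightarrow> \<omega> y > \<omega> x \<and> \<mu> y < \<mu> x"
    using 3(5)[of x y] 3(5)[of y x] by auto
  ultimately show ?case
    by (cases "x \<in> S"; cases "y \<in> S") auto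
qed auto

section \<open>Suborders, minimal elements and splitting of lists\<close>

lemma partial_order_on'D:
  assumes "partial_order_on' P le"
  shows "x \<in> P \<Longrightarrow> le x x"
    and "x \<in> P \<Longrightarrow> y \<in> P \<Longrightarrow> le x y \<Longrightarrow> le y x \<Longrightarrow> x = y"
    and "x \<in> P \<Longrightarrow> y \<in> P \<Longrightarrow> z \<in> P \<Longrightarrow> le x y \<Longrightarrow> le y z \<Longrightarrow> le x z"
  using assms unfolding partial_order_on'_def by meson+

lemma partial_order_on'_subset:
  assumes "partial_order_on' P le" "Q \<subseteq> P"
  shows "partial_order_on' Q le"
  using assms unfolding partial_order_on'_def by (meson subsetD)

lemma exists_minimal_below:
  assumes "finite P" "partial_order_on' P le" "x \<in> P"
  shows "\<exists>m. minimal_in P le m \<and> le m x"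
  using assms(3)
proof (induction "card {w \<in> P. le w x}" arbitrary: x rule: less_induct)
  case less
  note po = partial_order_on'D[OF assms(2)]
  show ?case
  proof (cases "minimal_in P le x")
    case True
    then show ?thesis using po(1) less.prems by auto
  next
    case False
    then obtain z where z: "z \<in> P" "le z x" "z \<noteq> x"
      using less.prems by (auto simp: minimal_in_def)
    have "{w \<in> P. le w z} \<subseteq> {w \<in> P. le w x}"
      using z less.prems po(3)[of _ z x] by auto
    moreover have "x \<in> {w \<in> P. le w x}" "x \<notin> {w \<in> P. le w z}"
      using z less.prems po(1)[of x] po(2)[of x z] by auto
    ultimately have "{w \<in> P. le w z} \<subset> {w \<in> P. le w x}"
      by blast
    then have "card {w \<in> P. le w z} < card {w \<in> P. le w x}"
      using assms(1) by (intro psubset_card_mono) auto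
    then obtain m where "minimal_in P le m" "le m z"
      using less.hyps[of z] z by auto
    then show ?thesis
      using po(3)[of m z x] z less.prems by (auto simp: minimal_in_def)
  qed
qed

text \<open>From the first letter outside \<open>M\<close> on, all letters are outside
  \<open>M\<close>, so those in \<open>M\<close> form a prefix.\<close>

lemma filter_append_filter:
  "sorted_wrt (\<lambda>x y. y \<in> M \<longrightarrow> x \<in> M) xs \<Longrightarrow> filter (\<lambda>x. x \<in> M) xs @ filter (\<lambda>x. x \<notin> M) xs = xs"
proof (induction xs)
  case (Cons x xs)
  show ?case
  proof (cases "x \<in> M")
    case False
    then have "\<forall>y\<in>set xs. y \<notin> M" using Cons.prems by auto
    then have "filter (\<lambda>x. x \<in> M) xs = []" "filter (\<lambda>x. x \<notin> M) xs = xs"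
      by (auto simp: filter_empty_conv filter_id_conv)
    then show ?thesis using False by simp
  qed (use Cons in auto)
qed simp

section \<open>Rank functions, ordinal sums, and the case where different ranks are
  comparable\<close>

text \<open>The difference \<open>b - a\<close> plays the part of the rank \<open>r\<close>. Since
  \<open>\<rho>\<close> may fall along a cover, \<open>a\<close> need not be its least value nor
  \<open>b\<close> its greatest. Natural values allow induction on the sum of the ranks.\<close>

definition rank_function :: "'a set \<Rightarrow> ('a \<Rightarrow> 'a \<Rightarrow> bool) \<Rightarrow> ('a \<Rightarrow> nat) \<Rightarrow> nat \<Rightarrow> nat \<Rightarrow> bool" where
  "rank_function P le \<rho> a b \<longleftrightarrow>
     (\<forall>x y. covers P le x y \<longrightarrow> \<rho> y = Suc (\<rho> x) \<or> \<rho> x = Suc (\<rho> y)) \<and>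
     (\<forall>x. minimal_in P le x \<longrightarrow> \<rho> x = a) \<and> (\<forall>x. maximal_in P le x \<longrightarrow> \<rho> x = b)"

text \<open>A linear extension is an arbitrary arrangement of the antichain \<open>M\<close>
  followed by a linear extension of the rest. The second part starts with a minimal element of
  \<open>P - M\<close>, so \<open>d\<close> tells, uniformly for all words, whether the junction is
  a descent.\<close>

lemma W_labeling_ordinal_sum:
  assumes fin: "finite P" and po: "partial_order_on' P le" and part: "M \<subseteq> P" "M \<noteq> {}" "M \<noteq> P"
    and antichain: "\<And>x y. x \<in> M \<Longrightarrow> y \<in> M \<Longrightarrow> le x y \<Longrightarrow> x = y"
    and below: "\<And>x y. x \<in> M \<Longrightarrow> y \<in> P - M \<Longrightarrow> le x y"
    and desc: "\<And>x y. x \<in> M \<Longrightarrow> minimal_in (P - M) le y \<Longrightarrow> \<omega> x > \<omega> y \<longleftrightarrow> d"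
  shows "W_labeling P le \<omega> =
    (\<Sum>xs\<in>permutations_of_set M. monom 1 (des (map \<omega> xs))) * monom 1 (of_bool d) * W_labeling (P - M) le \<omega>"
proof -
  let ?Q = "P - M" and ?A = "permutations_of_set M"
  let ?L = "{vs. linear_extension ?Q le vs}"
  have poQ: "partial_order_on' ?Q le" using partial_order_on'_subset[OF po] by blast
  have le_dest: "\<not> le y x" if "x \<in> M" "y \<in> ?Q" for x y
    using that partial_order_on'D(2)[OF po, of x y] below[OF that] part(1) by auto
  have decomp: "filter (\<lambda>x. x \<in> M) xs @ filter (\<lambda>x. x \<notin> M) xs = xs"
    if "linear_extension P le xs" for xs
  proof (rule filter_append_filter)
    have "sorted_wrt (\<lambda>x y. \<not> le y x) xs" "set xs = P"
      using that by (auto simp: linear_extension_iff_sorted_wrt[OF po])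
    then show "sorted_wrt (\<lambda>x y. y \<in> M \<longrightarrow> x \<in> M) xs"
      using below by (auto elim!: sorted_wrt_mono_rel[rotated])
  qed
  have lin: "linear_extension P le (us @ vs)"
    if "us \<in> ?A" "vs \<in> ?L" for us vs
  proof -
    have "sorted_wrt (\<lambda>x y. \<not> le y x) us"
      unfolding sorted_wrt_iff_nth_less
    proof (intro allI impI)
      fix i j assume "i < j" "j < length us"
      then show "\<not> le (us ! j) (us ! i)"
        using that(1) antichain[of "us ! j" "us ! i"] nth_eq_iff_index_eq[of us i j]
        by (auto simp: permutations_of_set_def)
    qed
    then show ?thesis
      using that le_dest part(1) unfolding linear_extension_iff_sorted_wrt[OF po] mem_Collect_eq
        linear_extension_iff_sorted_wrt[OF poQ] permutations_of_set_def
      by (auto simp: sorted_wrt_append)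
  qed
  have "W_labeling P le \<omega> = (\<Sum>(us, vs)\<in>?A \<times> ?L. monom 1 (des (map \<omega> (us @ vs))))"
    unfolding W_labeling_def
  proof (rule sum.reindex_bij_witness[where i = "\<lambda>(us, vs). us @ vs" and
        j = "\<lambda>xs. (filter (\<lambda>x. x \<in> M) xs, filter (\<lambda>x. x \<notin> M) xs)"])
    fix xs assume "xs \<in> {xs. linear_extension P le xs}"
    then have xs: "linear_extension P le xs" by simp
    have d: "distinct xs" "set xs = P" using xs by (auto simp: linear_extension_def)
    have "linear_extension ?Q le (filter (\<lambda>x. x \<notin> M) xs)"
      using xs unfolding linear_extension_iff_sorted_wrt[OF po] linear_extension_iff_sorted_wrt[OF poQ]
      by (auto intro: sorted_wrt_filter)
    then show "(filter (\<lambda>x. x \<in> M) xs, filter (\<lambda>x. x \<notin> M) xs) \<in> ?A \<times> ?L"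
      using d part(1) by (auto simp: permutations_of_set_def)
  next
    fix z assume z: "z \<in> ?A \<times> ?L"
    then obtain us vs where zz: "z = (us, vs)" "us \<in> ?A" "vs \<in> ?L" by auto
    have "set us = M" "set vs = ?Q"
      using zz by (auto simp: permutations_of_set_def linear_extension_def)
    then have "filter (\<lambda>x. x \<in> M) us = us" "filter (\<lambda>x. x \<in> M) vs = []"
       "filter (\<lambda>x. x \<notin> M) us = []" "filter (\<lambda>x. x \<notin> M) vs = vs"
      by (auto simp: filter_empty_conv filter_id_conv)
    then show "(\<lambda>xs. (filter (\<lambda>x. x \<in> M) xs, filter (\<lambda>x. x \<notin> M) xs)) ((\<lambda>(us, vs). us @ vs) z) = z"
      using zz by simp
    show "(\<lambda>(us, vs). us @ vs) z \<in> {xs. linear_extension P le xs}"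
      using zz lin by simp
  qed (simp_all add: decomp del: map_append)
  also have "\<dots> = (\<Sum>(us, vs)\<in>?A \<times> ?L. monom 1 (des (map \<omega> us)) * monom 1 (of_bool d) * monom 1 (des (map \<omega> vs)))"
  proof (intro sum.cong refl, clarify)
    fix us vs assume uv: "us \<in> ?A" "linear_extension ?Q le vs"
    have ne: "us \<noteq> []" "vs \<noteq> []"
      using uv part by (auto simp: permutations_of_set_def linear_extension_def)
    have "minimal_in ?Q le (hd vs)" "last us \<in> M"
      using hd_linear_extension_minimal[OF poQ uv(2)] ne uv(1) by (auto simp: permutations_of_set_def)
    then have "\<omega> (last us) > \<omega> (hd vs) \<longleftrightarrow> d" using desc by auto
    then have "des (map \<omega> (us @ vs)) = des (map \<omega> us) + of_bool d + des (map \<omega> vs)"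
      using ne by (simp add: des_append last_map hd_map)
    then show "monom (1::real) (des (map \<omega> (us @ vs))) =
        monom 1 (des (map \<omega> us)) * monom 1 (of_bool d) * monom 1 (des (map \<omega> vs))"
      by (simp add: mult_monom)
  qed
  also have "\<dots> = (\<Sum>us\<in>?A. monom 1 (des (map \<omega> us))) * monom 1 (of_bool d) * W_labeling ?Q le \<omega>"
    unfolding W_labeling_def sum_distrib_right[of _ ?A] sum_product sum.cartesian_product ..
  finally show ?thesis .
qed

text \<open>The set \<open>M\<close> of minimal elements is split off repeatedly. It lies below
  everything else, and the next minimal elements have the other rank \<open>1 - a\<close>, so the
  junction is a descent exactly when the rank falls from 1 to 0.\<close>

lemma W_labeling_saturated:
  assumes "finite P" "P \<noteq> {}" "partial_order_on' P le" "inj_on \<omega> P" "rank_function P le \<rho> a b"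
    and "\<And>x. x \<in> P \<Longrightarrow> \<rho> x \<le> 1"
    and "\<And>x y. x \<in> P \<Longrightarrow> y \<in> P \<Longrightarrow> \<rho> x < \<rho> y \<Longrightarrow> \<omega> x < \<omega> y"
    and "\<And>x y. x \<in> P \<Longrightarrow> y \<in> P \<Longrightarrow> \<rho> x \<noteq> \<rho> y \<Longrightarrow> le x y \<or> le y x"
  shows "W_labeling P le \<omega> \<in> S_plus_int (int (card P) - 1 - int b + int a)"
  using assms
proof (induction "card P" arbitrary: P a rule: less_induct)
  case less
  note fin = less.prems(1) and po = less.prems(3) and inj = less.prems(4)
    and rank = less.prems(5) and le1 = less.prems(6) and mono = less.prems(7) and comp = less.prems(8)
  note le = partial_order_on'D[OF po]
  define M where "M = {x. minimal_in P le x}"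
  define Q where "Q = P - M"
  have M: "M \<subseteq> P" "M \<noteq> {}" "finite M"
    using exists_minimal_below[OF fin po] less.prems(2) fin finite_subset[of M P]
    by (auto simp: M_def minimal_in_def)
  have minM: "y = x" if "x \<in> M" "y \<in> P" "le y x" for x y
    using that by (auto simp: M_def minimal_in_def)
  have \<rho>M: "\<rho> x = a" if "x \<in> M" for x
    using that rank by (auto simp: M_def rank_function_def)
  have a1: "a \<le> 1" using M \<rho>M le1 by blast
  have step: "\<rho> y = Suc (\<rho> x) \<or> \<rho> x = Suc (\<rho> y)" if "covers P le x y" for x y
    using that rank by (auto simp: rank_function_def)
  have cov: "\<exists>c. covers P le c z" if "z \<in> Q" for z
  proof -
    obtain z' where "z' \<in> P" "le z' z" "z' \<noteq> z"
      using \<open>z \<in> Q\<close> by (auto simp: Q_def M_def minimal_in_def)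
    then show ?thesis using exists_cover_below[OF fin po, of z' z] \<open>z \<in> Q\<close> by (auto simp: Q_def)
  qed
  have below': "le m z" if "m \<in> M" "z \<in> Q" "\<rho> z \<noteq> a" for m z
    using that comp[of m z] \<rho>M[of m] minM[of m z] M(1) by (auto simp: Q_def)
  \<comment> \<open>An element \<open>z\<close> of rank \<open>a\<close> is reached through an
    element \<open>c\<close> that it covers: \<open>c\<close> has another rank, hence is above all
    of \<open>M\<close>.\<close>
  have below: "le m z" if "m \<in> M" "z \<in> Q" for m z
  proof (cases "\<rho> z = a")
    case True
    obtain c where c: "covers P le c z" using cov \<open>z \<in> Q\<close> by blast
    then have "\<rho> c \<noteq> a" using step[OF c] True by linarith
    then have "c \<in> Q" using c \<rho>M by (auto simp: Q_def covers_def)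
    then have "le m c" using below' that \<open>\<rho> c \<noteq> a\<close> by blast
    then show ?thesis
      using le(3)[of m c z] c that M(1) by (auto simp: covers_def)
  qed (use below' that in blast)
  have antichain: "x = y" if "x \<in> M" "y \<in> M" "le x y" for x y
    using minM that M(1) by blast
  show ?case
  proof (cases "Q = {}")
    case True
    then have PM: "P = M" using M(1) by (auto simp: Q_def)
    have "{xs. linear_extension P le xs} = permutations_of_set M"
    proof (intro set_eqI iffI)
      fix xs assume "xs \<in> permutations_of_set M"
      then have xs: "distinct xs" "set xs = P" using PM by (auto simp: permutations_of_set_def)
      have "i \<le> j" if "i < length xs" "j < length xs" "le (xs ! i) (xs ! j)" for i j
        using that xs antichain[of "xs ! i" "xs ! j"] PM nth_eq_iff_index_eq[of xs i j] by auto
      then show "xs \<in> {xs. linear_extension P le xs}" using xs by (auto simp: linear_extension_def)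
    qed (auto simp: linear_extension_def permutations_of_set_def PM)
    then have "W_labeling P le \<omega> \<in> S_plus_int (int (card M) - 1)"
      unfolding W_labeling_def using Eulerian_in_S_plus_int[of M \<omega>] M inj PM by simp
    \<comment> \<open>In an antichain every element is both minimal and maximal.\<close>
    moreover have "a = b"
    proof -
      obtain x where x: "x \<in> M" using M by blast
      have "maximal_in P le x"
        using x antichain PM unfolding maximal_in_def by blast
      then show ?thesis using rank \<rho>M[OF x] unfolding rank_function_def by auto
    qed
    ultimately show ?thesis using PM by simp
  next
    case False
    \<comment> \<open>What is covered by a minimal element of \<open>Q\<close> belongs to
      \<open>M\<close> and has rank \<open>a\<close>; the only other rank is
      \<open>1 - a\<close>.\<close>
    have minQ: "\<rho> y = 1 - a" if "minimal_in Q le y" for y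
    proof -
      have "y \<in> Q" using that by (auto simp: minimal_in_def)
      then obtain c where c: "covers P le c y" using cov by blast
      then have "c \<notin> Q" using that by (auto simp: minimal_in_def covers_def)
      then have "\<rho> c = a" using c \<rho>M by (auto simp: covers_def Q_def)
      moreover have "\<rho> y \<le> 1" using le1 c by (auto simp: covers_def)
      ultimately show ?thesis using step[OF c] a1 by presburger
    qed
    have "\<omega> x > \<omega> y \<longleftrightarrow> a = 1" if "x \<in> M" "minimal_in Q le y" for x y
    proof -
      have "x \<in> P" "y \<in> P" using that M(1) by (auto simp: minimal_in_def Q_def)
      then have "\<rho> x < \<rho> y \<Longrightarrow> \<omega> x < \<omega> y" "\<rho> y < \<rho> x \<Longrightarrow> \<omega> y < \<omega> x"
        using mono by blast+
      moreover have "a = 0 \<or> a = 1" using a1 by linarith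
      ultimately show ?thesis
        using minQ[OF that(2)] \<rho>M[OF that(1)] by force
    qed
    then have W: "W_labeling P le \<omega> =
       (\<Sum>xs\<in>permutations_of_set M. monom 1 (des (map \<omega> xs))) * monom 1 (of_bool (a = 1)) * W_labeling Q le \<omega>"
      unfolding Q_def using M antichain below False
      by (intro W_labeling_ordinal_sum fin po) (auto simp: Q_def)
    have "card Q < card P" using M fin unfolding Q_def by (intro psubset_card_mono) auto
    moreover have "rank_function Q le \<rho> (1 - a) b"
      unfolding rank_function_def
    proof (intro conjI allI impI)
      fix x y assume xy: "covers Q le x y"
      \<comment> \<open>No element of \<open>M\<close> lies above an element of \<open>Q\<close>, so
        restoring \<open>M\<close> puts nothing between \<open>x\<close> and
        \<open>y\<close>.\<close>
      then have "covers P le x y"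
        using minM[of _ x] unfolding covers_def Q_def by blast
      then show "\<rho> y = Suc (\<rho> x) \<or> \<rho> x = Suc (\<rho> y)" by (rule step)
    next
      fix x assume "maximal_in Q le x"
      then have "maximal_in P le x" using minM[of _ x] unfolding maximal_in_def Q_def by blast
      then show "\<rho> x = b" using rank by (auto simp: rank_function_def)
    qed (rule minQ)
    ultimately have IH: "W_labeling Q le \<omega> \<in> S_plus_int (int (card Q) - 1 - int b + int (1 - a))"
      using fin False inj le1 mono comp partial_order_on'_subset[OF po, of Q]
      by (intro less.hyps) (auto simp: Q_def intro: inj_on_subset)
    have "inj_on \<omega> M" using inj M(1) by (rule inj_on_subset)
    \<comment> \<open>Each split lowers the sum of degrees by one more. This is made good by the
      change from \<open>a\<close> to \<open>1 - a\<close> if \<open>a = 0\<close>, and by the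
      degree 2 of t, less that change, if \<open>a = 1\<close>.\<close>
    then have "W_labeling P le \<omega> \<in> S_plus_int ((int (card M) - 1) + 2 * int (of_bool (a = 1)) +
        (int (card Q) - 1 - int b + int (1 - a)))"
      unfolding W using M by (intro S_plus_int_mult IH Eulerian_in_S_plus_int monom_in_S_plus_int)
    moreover have "card P = card M + card Q"
      using M fin card_Diff_subset[of M P] card_mono[of P M] by (simp add: Q_def)
    moreover have "a = 0 \<or> a = 1" using a1 by auto
    ultimately show ?thesis by (auto simp: algebra_simps)
  qed
qed

section \<open>Making an incomparable pair comparable\<close>

text \<open>The relation generated by \<open>le\<close> and the pair \<open>(x, y)\<close>: passing
  through the new pair more than once would give nothing more.\<close>

definition add_relation :: "('a \<Rightarrow> 'a \<Rightarrow> bool) \<Rightarrow> 'a \<Rightarrow> 'a \<Rightarrow> 'a \<Rightarrow> 'a \<Rightarrow> bool" where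
  "add_relation le x y u v \<longleftrightarrow> le u v \<or> le u x \<and> le y v"

lemma partial_order_on'_add_relation:
  assumes po: "partial_order_on' P le" and xy: "x \<in> P" "y \<in> P" "\<not> le y x"
  shows "partial_order_on' P (add_relation le x y)"
  unfolding partial_order_on'_def
proof (intro conjI ballI impI)
  note le = partial_order_on'D[OF po]
  {
    fix u assume "u \<in> P"
    then show "add_relation le x y u u" using le(1) by (simp add: add_relation_def)
  next
    fix u v assume "u \<in> P" "v \<in> P" "add_relation le x y u v \<and> add_relation le x y v u"
    then show "u = v" using xy unfolding add_relation_def by (metis le(2,3))
  next
    fix u v w assume "u \<in> P" "v \<in> P" "w \<in> P" "add_relation le x y u v \<and> add_relation le x y v w"
    then show "add_relation le x y u w" using xy unfolding add_relation_def by (metis le(3))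
  }
qed

text \<open>A pair related only through the new relation has \<open>x\<close> and \<open>y\<close>
  between its ends, so it can be a cover only if they are its ends.\<close>

lemma covers_add_relation:
  assumes po: "partial_order_on' P le" and xy: "x \<in> P" "y \<in> P" "\<not> le y x"
    and cov: "covers P (add_relation le x y) u v"
  shows "covers P le u v \<or> u = x \<and> v = y"
proof -
  note le = partial_order_on'D[OF po]
  have uv: "u \<in> P" "v \<in> P" "u \<noteq> v" "le u v \<or> le u x \<and> le y v"
    and no: "\<And>z. z \<in> P \<Longrightarrow> add_relation le x y u z \<Longrightarrow> add_relation le x y z v \<Longrightarrow> z = u \<or> z = v"
    using cov by (auto simp: covers_def add_relation_def)
  show ?thesis
  proof (cases "le u v")
    case True
    then show ?thesis using uv no unfolding covers_def add_relation_def by blast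
  next
    case False
    then have "le u x" "le y v" using uv by auto
    then show ?thesis using no[of x] no[of y] xy le(1)[of x] le(1)[of y] unfolding add_relation_def by blast
  qed
qed

text \<open>Enlarging the order creates no new minimal or maximal elements, and the only possible
  new cover is \<open>(x, y)\<close>, whose ranks differ by one.\<close>

lemma rank_function_add_relation:
  assumes po: "partial_order_on' P le" and xy: "x \<in> P" "y \<in> P" "\<not> le y x"
    and "rank_function P le \<rho> a b" and "\<rho> y = Suc (\<rho> x) \<or> \<rho> x = Suc (\<rho> y)"
  shows "rank_function P (add_relation le x y) \<rho> a b"
  unfolding rank_function_def
proof (intro conjI allI impI)
  fix u v assume "covers P (add_relation le x y) u v"
  then show "\<rho> v = Suc (\<rho> u) \<or> \<rho> u = Suc (\<rho> v)"
    using covers_add_relation[OF po xy] assms(5,6) unfolding rank_function_def by blast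
next
  fix u assume "minimal_in P (add_relation le x y) u"
  then have "minimal_in P le u" by (auto simp: minimal_in_def add_relation_def)
  then show "\<rho> u = a" using assms(5) by (auto simp: rank_function_def)
next
  fix u assume "maximal_in P (add_relation le x y) u"
  then have "maximal_in P le u" by (auto simp: maximal_in_def add_relation_def)
  then show "\<rho> u = b" using assms(5) by (auto simp: rank_function_def)
qed

lemma linear_extension_add_relation:
  assumes xy: "x \<in> P" "y \<in> P" and i: "xs ! i = x" "i < length xs" and j: "xs ! j = y" "j < length xs"
    and lin: "linear_extension P le xs" and refl: "le x x" "le y y"
  shows "linear_extension P (add_relation le x y) xs \<longleftrightarrow> i \<le> j"
proof
  assume "linear_extension P (add_relation le x y) xs"
  then show "i \<le> j" using i j refl unfolding linear_extension_def add_relation_def by blast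
next
  assume ij: "i \<le> j"
  have "k \<le> l" if "k < length xs" "l < length xs" "add_relation le x y (xs ! k) (xs ! l)" for k l
  proof (cases "le (xs ! k) (xs ! l)")
    case True
    then show ?thesis using lin that unfolding linear_extension_def by blast
  next
    case False
    then have "le (xs ! k) (xs ! i)" "le (xs ! j) (xs ! l)"
      using that i j by (auto simp: add_relation_def)
    then have "k \<le> i" "j \<le> l" using lin that i j unfolding linear_extension_def by blast+
    then show ?thesis using ij by simp
  qed
  then show "linear_extension P (add_relation le x y) xs"
    using lin unfolding linear_extension_def by blast
qed

text \<open>Every linear extension of \<open>le\<close> puts exactly one of \<open>x\<close> and
  \<open>y\<close> first and so respects exactly one of the two enlarged relations.\<close>

lemma W_labeling_add_relation:
  assumes fin: "finite P" and po: "partial_order_on' P le" and xy: "x \<in> P" "y \<in> P" "x \<noteq> y"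
  shows "W_labeling P le \<omega> = W_labeling P (add_relation le x y) \<omega> + W_labeling P (add_relation le y x) \<omega>"
proof -
  let ?A = "{xs. linear_extension P (add_relation le x y) xs}"
  let ?B = "{xs. linear_extension P (add_relation le y x) xs}"
  have iff: "(linear_extension P le xs \<longleftrightarrow> linear_extension P (add_relation le x y) xs \<or> linear_extension P (add_relation le y x) xs)
     \<and> \<not> (linear_extension P (add_relation le x y) xs \<and> linear_extension P (add_relation le y x) xs)" for xs
  proof (cases "linear_extension P le xs")
    case True
    then have "set xs = P" by (simp add: linear_extension_def)
    then obtain i j where i: "xs ! i = x" "i < length xs" and j: "xs ! j = y" "j < length xs"
      using xy by (metis in_set_conv_nth)
    have refl: "le x x" "le y y" using partial_order_on'D(1)[OF po] xy by auto
    have "i \<noteq> j" using i j xy by auto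
    then show ?thesis
      using True linear_extension_add_relation[OF xy(1,2) i j True refl]
       linear_extension_add_relation[OF xy(2,1) j i True refl(2,1)] by auto
  next
    case False
    then show ?thesis by (auto simp: linear_extension_def add_relation_def)
  qed
  then have "{xs. linear_extension P le xs} = ?A \<union> ?B" "?A \<inter> ?B = {}" by blast+
  then show ?thesis
    unfolding W_labeling_def using finite_linear_extensions[OF fin] by (simp add: sum.union_disjoint)
qed

text \<open>Induction on the number of incomparable pairs of different rank. Enlarging the order
  changes neither \<open>a\<close>, \<open>b\<close> nor the number of elements, so both summands
  lie in the same cone.\<close>

lemma W_labeling_rank_le_1:
  assumes "finite P" "P \<noteq> {}" "partial_order_on' P le" "inj_on \<omega> P" "rank_function P le \<rho> a b"
    and "\<And>x. x \<in> P \<Longrightarrow> \<rho> x \<le> 1"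
    and "\<And>x y. x \<in> P \<Longrightarrow> y \<in> P \<Longrightarrow> \<rho> x < \<rho> y \<Longrightarrow> \<omega> x < \<omega> y"
  shows "W_labeling P le \<omega> \<in> S_plus_int (int (card P) - 1 - int b + int a)"
  using assms(3,5)
proof (induction "card {(u, v) \<in> P \<times> P. \<rho> u \<noteq> \<rho> v \<and> \<not> le u v \<and> \<not> le v u}" arbitrary: le rule: less_induct)
  case less
  let ?I = "\<lambda>le. {(u, v) \<in> P \<times> P. \<rho> u \<noteq> \<rho> v \<and> \<not> le u v \<and> \<not> le v u}"
  show ?case
  proof (cases "?I le = {}")
    case True
    then have "le x y \<or> le y x" if "x \<in> P" "y \<in> P" "\<rho> x \<noteq> \<rho> y" for x y
      using that by blast
    then show ?thesis
      using assms less.prems by (intro W_labeling_saturated[of P le \<omega> \<rho>]) auto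
  next
    case False
    then obtain x y where xy: "x \<in> P" "y \<in> P" "\<rho> x \<noteq> \<rho> y" "\<not> le x y" "\<not> le y x"
      by blast
    have "W_labeling P (add_relation le u v) \<omega> \<in> S_plus_int (int (card P) - 1 - int b + int a)"
      if uv: "(u, v) \<in> {(x, y), (y, x)}" for u v
    proof (rule less.hyps)
      have uv': "u \<in> P" "v \<in> P" "\<rho> u \<noteq> \<rho> v" "\<not> le u v" "\<not> le v u" using uv xy by auto
      have "add_relation le u v u v"
        using uv' partial_order_on'D(1)[OF less.prems(1)] by (simp add: add_relation_def)
      then have "?I (add_relation le u v) \<subseteq> ?I le - {(u, v)}"
        by (auto simp: add_relation_def)
      moreover have "(u, v) \<in> ?I le" using uv' by auto
      ultimately have "?I (add_relation le u v) \<subset> ?I le" by blast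
      then show "card (?I (add_relation le u v)) < card (?I le)"
        using assms(1) by (intro psubset_card_mono) (auto intro: finite_subset[of _ "P \<times> P"])
      show "partial_order_on' P (add_relation le u v)"
        using partial_order_on'_add_relation[OF less.prems(1)] uv' by blast
      \<comment> \<open>Ranks at most 1 that differ do so by exactly one; this is what lets the new
        pair become a cover.\<close>
      have "\<rho> v = Suc (\<rho> u) \<or> \<rho> u = Suc (\<rho> v)"
        using uv' assms(6)[of u] assms(6)[of v] by linarith
      then show "rank_function P (add_relation le u v) \<rho> a b"
        using rank_function_add_relation[OF less.prems(1) _ _ _ less.prems(2)] uv' by blast
    qed
    moreover have "x \<noteq> y" using xy by auto
    ultimately show ?thesis
      unfolding W_labeling_add_relation[OF assms(1) less.prems(1) xy(1,2) \<open>x \<noteq> y\<close>, of \<omega>]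
      by (intro S_plus_int_add) auto
  qed
qed

section \<open>Reduction to ranks 0 and 1 by moving down the top rank\<close>

text \<open>For second components below \<open>N\<close>, the number \<open>k * N + i\<close>
  encodes the lexicographic order of the pairs \<open>(k, i)\<close>; this yields labels sorted by
  rank first.\<close>

lemma lex_label_less:
  fixes N :: nat
  assumes "k < l" "i < N"
  shows "k * N + i < l * N + j"
proof -
  have "k * N + i < Suc k * N" using assms(2) by simp
  also have "\<dots> \<le> l * N" using assms(1) by (intro mult_le_mono1) simp
  finally show ?thesis by simp
qed

text \<open>Induction on the sum of the ranks. While the top rank \<open>m\<close> is at least 2, it
  is replaced by \<open>m - 2\<close>. The labelings \<open>\<mu>\<close> and \<open>\<nu>\<close>
  fit the old and the new ranks, and differ in whether the top rank gets the largest or the smallest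
  labels.\<close>

lemma W_labeling_rank_function:
  assumes fin: "finite P" and ne: "P \<noteq> {}" and po: "partial_order_on' P le"
    and "inj_on \<omega> P" "rank_function P le \<rho> a b"
    and "\<And>x y. covers P le x y \<Longrightarrow> \<omega> x < \<omega> y \<longleftrightarrow> \<rho> x < \<rho> y"
  shows "W_labeling P le \<omega> \<in> S_plus_int (int (card P) - 1 - int b + int a)"
  using assms(4-)
proof (induction "\<Sum>x\<in>P. \<rho> x" arbitrary: \<rho> \<omega> a b rule: less_induct)
  case less
  note inj = less.prems(1) and rank = less.prems(2) and compat = less.prems(3)
  obtain N where N: "\<And>x. x \<in> P \<Longrightarrow> \<omega> x < N"
    using finite_nat_set_iff_bounded[of "\<omega> ` P"] fin by auto
  have step: "\<rho> y = Suc (\<rho> x) \<or> \<rho> x = Suc (\<rho> y)" if "covers P le x y" for x y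
    using that rank by (auto simp: rank_function_def)
  define \<mu> where "\<mu> x = \<rho> x * N + \<omega> x" for x
  have less_\<mu>: "\<mu> x < \<mu> y" if "x \<in> P" "\<rho> x < \<rho> y" for x y
    using lex_label_less[OF that(2) N[OF that(1)]] by (simp add: \<mu>_def)
  \<comment> \<open>Labels built as a multiple of \<open>N\<close> plus \<open>\<omega> x\<close>
    remember \<open>\<omega> x\<close> as their remainder.\<close>
  have inj_mod: "inj_on \<nu> P" if "\<And>x. x \<in> P \<Longrightarrow> \<nu> x mod N = \<omega> x" for \<nu> :: "'a \<Rightarrow> nat"
    using inj that by (metis inj_on_def)
  have inj\<mu>: "inj_on \<mu> P"
    by (rule inj_mod) (use N in \<open>simp add: \<mu>_def\<close>)
  have compat\<mu>: "\<mu> x < \<mu> y \<longleftrightarrow> \<rho> x < \<rho> y" if "covers P le x y" for x y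
    using less_\<mu>[of x y] less_\<mu>[of y x] step[OF that] that by (auto simp: covers_def)
  have W\<mu>: "W_labeling P le \<omega> = W_labeling P le \<mu>"
    using compat compat\<mu> by (intro W_labeling_cong_covers fin po inj inj\<mu>) simp
  show ?case
  proof (cases "\<forall>x\<in>P. \<rho> x \<le> 1")
    case True
    then show ?thesis
      unfolding W\<mu> using less_\<mu> by (intro W_labeling_rank_le_1[OF fin ne po inj\<mu> rank]) auto
  next
    case False
    define m where "m = Max (\<rho> ` P)"
    have m: "\<rho> x \<le> m" if "x \<in> P" for x
      using that fin by (simp add: m_def)
    have "m \<in> \<rho> ` P" unfolding m_def using fin ne by simp
    then obtain x0 where x0: "x0 \<in> P" "\<rho> x0 = m" by auto
    have m2: "2 \<le> m" using False m by fastforce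
    have top: "\<rho> x = m \<and> Suc (\<rho> y) = m \<or> \<rho> y = m \<and> Suc (\<rho> x) = m \<or> \<rho> x \<noteq> m \<and> \<rho> y \<noteq> m"
      if "covers P le x y" for x y
      using step[OF that] m[of x] m[of y] that unfolding covers_def by linarith
    \<comment> \<open>The value \<open>m - 2\<close> has the same distance to \<open>m - 1\<close>
      as \<open>m\<close> but lies on its other side, and covers meet the top rank only from
      \<open>m - 1\<close>.\<close>
    define fold where "fold k = (if k = m then m - 2 else k)" for k
    \<comment> \<open>The \<open>Suc\<close> keeps the labels below \<open>N\<close> free for the
      elements of top rank.\<close>
    define \<nu> where "\<nu> x = (if \<rho> x = m then \<omega> x else Suc (\<rho> x) * N + \<omega> x)" for x
    have less_\<nu>: "\<nu> x < \<nu> y" if "x \<in> P" "\<rho> x = m" "\<rho> y \<noteq> m" for x y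
      using that lex_label_less[of 0 "Suc (\<rho> y)" "\<omega> x" N "\<omega> y"] N by (simp add: \<nu>_def del: mult_Suc)
    have "(\<Sum>x\<in>P. fold (\<rho> x)) < (\<Sum>x\<in>P. \<rho> x)"
      using fin x0 m2 by (intro sum_strict_mono_ex1) (auto simp: fold_def)
    moreover have "inj_on \<nu> P"
      by (rule inj_mod) (use N in \<open>simp add: \<nu>_def del: mult_Suc\<close>)
    moreover have "rank_function P le (\<lambda>x. fold (\<rho> x)) (fold a) (fold b)"
      unfolding rank_function_def
    proof (intro conjI allI impI)
      fix x y assume c: "covers P le x y"
      obtain n where n: "m = Suc (Suc n)" using m2 by (metis add_2_eq_Suc le_Suc_ex)
      from top[OF c] show "fold (\<rho> y) = Suc (fold (\<rho> x)) \<or> fold (\<rho> x) = Suc (fold (\<rho> y))"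
        using step[OF c] by (elim disjE conjE) (simp_all add: fold_def n)
    qed (use rank in \<open>auto simp: rank_function_def\<close>)
    moreover have "\<nu> x < \<nu> y \<longleftrightarrow> fold (\<rho> x) < fold (\<rho> y)" if c: "covers P le x y" for x y
    proof -
      have xy: "x \<in> P" "y \<in> P" "\<rho> x \<le> m" "\<rho> y \<le> m" using m c by (auto simp: covers_def)
      consider "\<rho> x = m" "Suc (\<rho> y) = m" | "\<rho> y = m" "Suc (\<rho> x) = m" | "\<rho> x \<noteq> m" "\<rho> y \<noteq> m"
        using top[OF c] by blast
      then show ?thesis
      proof cases
        case 1
        then have "fold (\<rho> x) < fold (\<rho> y)" using m2 by (auto simp: fold_def)
        moreover have "\<nu> x < \<nu> y" using 1 less_\<nu>[of x y] xy by simp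
        ultimately show ?thesis by simp
      next
        case 2
        then have "fold (\<rho> y) < fold (\<rho> x)" using m2 by (auto simp: fold_def)
        moreover have "\<nu> y < \<nu> x" using 2 less_\<nu>[of y x] xy by simp
        ultimately show ?thesis by simp
      next
        case 3
        then show ?thesis using compat\<mu>[OF c] by (simp add: \<nu>_def \<mu>_def fold_def)
      qed
    qed
    ultimately have IH: "W_labeling P le \<nu> \<in> S_plus_int (int (card P) - 1 - int (fold b) + int (fold a))"
      by (intro less.hyps)
    \<comment> \<open>Every word starts in rank \<open>a\<close> and ends in rank \<open>b\<close>,
      so the correction at its two ends does not depend on the word.\<close>
    have "des (map \<mu> xs) + of_bool (b = m) = des (map \<nu> xs) + of_bool (a = m)"
      if xs: "linear_extension P le xs" for xs
    proof -
      have set: "set xs = P" "xs \<noteq> []" using xs ne by (auto simp: linear_extension_def)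
      have "des (map \<mu> xs) + of_bool (last xs \<in> {x. \<rho> x = m}) = des (map \<nu> xs) + of_bool (hd xs \<in> {x. \<rho> x = m})"
      proof (rule des_flip)
        fix u v assume "u \<in> set xs" "v \<in> set xs" "u \<in> {x. \<rho> x = m} \<longleftrightarrow> v \<in> {x. \<rho> x = m}"
        then show "\<mu> u > \<mu> v \<longleftrightarrow> \<nu> u > \<nu> v" by (auto simp: \<mu>_def \<nu>_def)
      next
        fix u v assume "u \<in> set xs" "v \<in> set xs" "u \<in> {x. \<rho> x = m}" "v \<notin> {x. \<rho> x = m}"
        then have uv: "u \<in> P" "v \<in> P" "\<rho> u = m" "\<rho> v < m" using set m[of v] by auto
        then show "\<mu> u > \<mu> v \<and> \<nu> u < \<nu> v"
          using less_\<mu>[of v u] less_\<nu>[of u v] by simp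
      qed (rule set(2))
      moreover have "\<rho> (last xs) = b" "\<rho> (hd xs) = a"
        using last_linear_extension_maximal[OF po xs set(2)] hd_linear_extension_minimal[OF po xs set(2)] rank
        by (auto simp: rank_function_def)
      ultimately show ?thesis by simp
    qed
    then have "W_labeling P le \<mu> * monom 1 (of_bool (b = m)) = W_labeling P le \<nu> * monom 1 (of_bool (a = m))"
      unfolding W_labeling_def sum_distrib_right by (intro sum.cong) (auto simp: mult_monom)
    then have W: "monom 1 (of_bool (b = m)) * W_labeling P le \<mu> = monom 1 (of_bool (a = m)) * W_labeling P le \<nu>"
      by (simp add: mult.commute)
    \<comment> \<open>Dividing by t lowers the degree by 2, because t lies in degree 2.\<close>
    have divide: "g \<in> S_plus_int (e - 2 * int (of_bool c))" if "monom 1 (of_bool c) * g \<in> S_plus_int e" for c g e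
      using that S_plus_int_divide_monom[of g e] by (cases c) (simp_all add: monom_0)
    let ?d = "int (card P) - 1 - int (fold b) + int (fold a)"
    have "monom 1 (of_bool (a = m)) * W_labeling P le \<nu> \<in> S_plus_int (2 * int (of_bool (a = m)) + ?d)"
      by (intro S_plus_int_mult monom_in_S_plus_int IH)
    then have "W_labeling P le \<mu> \<in> S_plus_int (2 * int (of_bool (a = m)) + ?d - 2 * int (of_bool (b = m)))"
      unfolding W[symmetric] by (rule divide)
    \<comment> \<open>The factors t make up exactly for the shift by 2 that \<open>fold\<close>
      performs on \<open>a\<close> or \<open>b\<close>.\<close>
    moreover have "2 * int (of_bool (a = m)) + ?d - 2 * int (of_bool (b = m)) = int (card P) - 1 - int b + int a"
      using m2 by (auto simp: fold_def of_nat_diff)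
    ultimately show ?thesis unfolding W\<mu> by (simp only:)
  qed
qed

section \<open>Saturated chains and the rank function defined by their signs\<close>

lemma exists_chain_to:
  assumes "finite P" "partial_order_on' P le" "x \<in> P"
  shows "\<exists>us. set us \<subseteq> P \<and> successively (covers P le) (us @ [x]) \<and> minimal_in P le (hd (us @ [x]))"
  using assms(3)
proof (induction "card {w \<in> P. le w x}" arbitrary: x rule: less_induct)
  case less
  note le = partial_order_on'D[OF assms(2)]
  show ?case
  proof (cases "minimal_in P le x")
    case True
    then show ?thesis by (intro exI[of _ "[]"]) simp
  next
    case False
    then obtain z where "z \<in> P" "le z x" "z \<noteq> x"
      using less.prems by (auto simp: minimal_in_def)
    then obtain c where c: "covers P le c x"
      using exists_cover_below[OF assms(1,2)] less.prems by blast
    then have cP: "c \<in> P" "le c x" "c \<noteq> x" by (auto simp: covers_def)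
    have "{w \<in> P. le w c} \<subseteq> {w \<in> P. le w x}"
      using cP less.prems le(3)[of _ c x] by auto
    moreover have "x \<in> {w \<in> P. le w x}" "x \<notin> {w \<in> P. le w c}"
      using cP less.prems le(1)[of x] le(2)[of x c] by auto
    ultimately have "{w \<in> P. le w c} \<subset> {w \<in> P. le w x}" by blast
    then have "card {w \<in> P. le w c} < card {w \<in> P. le w x}"
      using assms(1) by (intro psubset_card_mono) auto
    then obtain us where us: "set us \<subseteq> P" "successively (covers P le) (us @ [c])" "minimal_in P le (hd (us @ [c]))"
      using less.hyps[of c] cP by blast
    then have "successively (covers P le) ((us @ [c]) @ [x])"
      using c by (subst successively_append_iff) simp
    moreover have "hd ((us @ [c]) @ [x]) = hd (us @ [c])" by (simp add: hd_append)
    ultimately show ?thesis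
      using us cP by (intro exI[of _ "us @ [c]"]) simp
  qed
qed

lemma exists_chain_from:
  assumes "finite P" "partial_order_on' P le" "x \<in> P"
  shows "\<exists>vs. set vs \<subseteq> P \<and> successively (covers P le) (x # vs) \<and> maximal_in P le (last (x # vs))"
proof -
  obtain us where us: "set us \<subseteq> P" "successively (covers P (\<lambda>x y. le y x)) (us @ [x])"
      "minimal_in P (\<lambda>x y. le y x) (hd (us @ [x]))"
    using exists_chain_to[OF assms(1) partial_order_on'_converse[OF assms(2)] assms(3)] by blast
  have "successively (covers P le) (rev (us @ [x]))"
    unfolding successively_rev using us(2) by (simp add: covers_converse[of P le])
  moreover have "maximal_in P le (last (rev (us @ [x])))"
    using us(3) unfolding last_rev minimal_in_def maximal_in_def by simp
  ultimately show ?thesis using us(1) by (intro exI[of _ "rev us"]) simp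
qed

lemma chain_sign_simps [simp]:
  "chain_sign \<omega> [x] = 0"
  "chain_sign \<omega> (x # y # zs) = eps \<omega> x y + chain_sign \<omega> (y # zs)"
  by (simp_all add: chain_sign_def sum.lessThan_Suc_shift del: sum.lessThan_Suc)

lemma chain_sign_append:
  "chain_sign \<omega> (us @ y # vs) = chain_sign \<omega> (us @ [y]) + chain_sign \<omega> (y # vs)"
proof (induction us)
  case (Cons u us)
  then show ?case by (cases us) simp_all
qed simp

text \<open>All chains from \<open>x\<close> up to a maximal element have the same sign sum: a fixed
  chain from a minimal element to \<open>x\<close> completes each of them to a maximal chain, of
  total \<open>r\<close>.\<close>

lemma rank_function_of_sign_graded:
  assumes "labeled_poset P le \<omega>" "sign_graded_rank P le \<omega> r"
  shows "\<exists>\<rho> :: 'a \<Rightarrow> int. (\<forall>x y. covers P le x y \<longrightarrow> \<rho> y = \<rho> x + eps \<omega> x y) \<and>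
    (\<forall>x. minimal_in P le x \<longrightarrow> \<rho> x = 0) \<and> (\<forall>x. maximal_in P le x \<longrightarrow> \<rho> x = r)"
proof -
  have fin: "finite P" and po: "partial_order_on' P le"
    using assms(1) by (auto simp: labeled_poset_def)
  define up where "up x vs \<longleftrightarrow> set vs \<subseteq> P \<and> successively (covers P le) (x # vs) \<and> maximal_in P le (last (x # vs))" for x vs
  define dn where "dn x us \<longleftrightarrow> set us \<subseteq> P \<and> successively (covers P le) (us @ [x]) \<and> minimal_in P le (hd (us @ [x]))" for x us
  have total: "chain_sign \<omega> (us @ [x]) + chain_sign \<omega> (x # vs) = r" if "x \<in> P" "dn x us" "up x vs" for x us vs
  proof -
    have "successively (covers P le) (us @ x # vs)"
      using that unfolding dn_def up_def by (auto simp: successively_append_iff)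
    moreover have "hd (us @ x # vs) = hd (us @ [x])" by (simp add: hd_append)
    moreover have "last (us @ x # vs) = last (x # vs)" by simp
    ultimately have "maximal_chain P le (us @ x # vs)"
      using that unfolding maximal_chain_def dn_def up_def successively_conv_nth minimal_in_def maximal_in_def
      by auto
    then show ?thesis
      using assms(2) by (simp add: sign_graded_rank_def flip: chain_sign_append)
  qed
  have ex_dn: "\<exists>us. dn x us" and ex_up: "\<exists>vs. up x vs" if "x \<in> P" for x
    using exists_chain_to[OF fin po that] exists_chain_from[OF fin po that] unfolding dn_def up_def by auto
  define ch where "ch x = (SOME vs. up x vs)" for x
  have ch: "up x (ch x)" if "x \<in> P" for x
    unfolding ch_def using someI_ex[OF ex_up[OF that]] .
  have unique: "chain_sign \<omega> (x # vs) = chain_sign \<omega> (x # ch x)" if "x \<in> P" "up x vs" for x vs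
  proof -
    obtain us where "dn x us" using ex_dn \<open>x \<in> P\<close> by blast
    then show ?thesis using total[of x us vs] total[of x us "ch x"] that ch by simp
  qed
  show ?thesis
  \<comment> \<open>The rank of \<open>x\<close> is what the total \<open>r\<close> leaves for the
    part below \<open>x\<close>; a cover of \<open>x\<close> followed by its chosen chain is again a
    chain from \<open>x\<close>.\<close>
  proof (intro exI[of _ "\<lambda>x. r - chain_sign \<omega> (x # ch x)"] conjI allI impI)
    fix x y assume c: "covers P le x y"
    then have xy: "x \<in> P" "y \<in> P" by (auto simp: covers_def)
    have "up x (y # ch y)" using ch[OF xy(2)] c xy unfolding up_def by auto
    from unique[OF xy(1) this]
    show "r - chain_sign \<omega> (y # ch y) = r - chain_sign \<omega> (x # ch x) + eps \<omega> x y" by simp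
  next
    fix x assume x: "minimal_in P le x"
    then have "x \<in> P" "dn x []" by (auto simp: dn_def minimal_in_def)
    then show "r - chain_sign \<omega> (x # ch x) = 0" using total[of x "[]" "ch x"] ch by simp
  next
    fix x assume x: "maximal_in P le x"
    then have "x \<in> P" "up x []" by (auto simp: up_def maximal_in_def)
    then show "r - chain_sign \<omega> (x # ch x) = r" using unique[of x "[]"] by simp
  qed
qed

section \<open>From integer to natural ranks, and the degree \<open>p - r - 1\<close>\<close>

theorem theorem4p2:
  fixes P :: "'a set" and le :: "'a \<Rightarrow> 'a \<Rightarrow> bool" and \<omega> :: "'a \<Rightarrow> nat" and r :: int
  assumes "labeled_poset P le \<omega>"
    and "sign_graded_rank P le \<omega> r"
  shows "map_poly of_int (Wpoly P le \<omega>) \<in> S_plus (nat (int (card P) - r - 1))"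
proof -
  have fin: "finite P" and ne: "P \<noteq> {}" and po: "partial_order_on' P le" and inj: "inj_on \<omega> P"
    using assms(1) by (auto simp: labeled_poset_def bij_betw_def)
  obtain \<rho> :: "'a \<Rightarrow> int" where step: "\<And>x y. covers P le x y \<Longrightarrow> \<rho> y = \<rho> x + eps \<omega> x y"
    and min: "\<And>x. minimal_in P le x \<Longrightarrow> \<rho> x = 0" and max: "\<And>x. maximal_in P le x \<Longrightarrow> \<rho> x = r"
    using rank_function_of_sign_graded[OF assms] by blast
  \<comment> \<open>Subtracting the least rank makes all ranks natural. As \<open>0\<close> and
    \<open>r\<close> are ranks too, no conversion by \<open>nat\<close> truncates, and
    \<open>k\<close> cancels in the degree.\<close>
  define k where "k = Min (\<rho> ` P)"
  have k: "k \<le> \<rho> x" if "x \<in> P" for x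
    using that fin by (simp add: k_def)
  obtain x where "x \<in> P" using ne by blast
  obtain u where u: "minimal_in P le u" using exists_minimal_below[OF fin po \<open>x \<in> P\<close>] by blast
  obtain v where v: "maximal_in P le v" using exists_chain_from[OF fin po \<open>x \<in> P\<close>] by blast
  have "k \<le> 0" "k \<le> r"
    using k[of u] k[of v] min[OF u] max[OF v] u v by (auto simp: minimal_in_def maximal_in_def)
  have eps: "eps \<omega> x y = 1 \<and> \<omega> x < \<omega> y \<or> eps \<omega> x y = -1 \<and> \<not> \<omega> x < \<omega> y" for x y
    by (simp add: eps_def)
  have cov: "k \<le> \<rho> x \<and> k \<le> \<rho> y" if "covers P le x y" for x y
    using that k by (auto simp: covers_def)
  have "W_labeling P le \<omega> \<in> S_plus_int (int (card P) - 1 - int (nat (r - k)) + int (nat (0 - k)))"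
  proof (rule W_labeling_rank_function[OF fin ne po inj, where \<rho> = "\<lambda>x. nat (\<rho> x - k)"])
    show "rank_function P le (\<lambda>x. nat (\<rho> x - k)) (nat (0 - k)) (nat (r - k))"
      unfolding rank_function_def
    proof (intro conjI allI impI)
      fix x y assume c: "covers P le x y"
      then show "nat (\<rho> y - k) = Suc (nat (\<rho> x - k)) \<or> nat (\<rho> x - k) = Suc (nat (\<rho> y - k))"
        using step[OF c] cov[OF c] eps[of x y] by linarith
    qed (simp_all add: min max)
    show "\<omega> x < \<omega> y \<longleftrightarrow> nat (\<rho> x - k) < nat (\<rho> y - k)" if "covers P le x y" for x y
      using step[OF that] cov[OF that] eps[of x y] by linarith
  qed
  then show ?thesis
    using S_plus_int_subset \<open>k \<le> 0\<close> \<open>k \<le> r\<close> unfolding Wpoly_eq_W_labeling[OF inj]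
    by (auto simp: algebra_simps)
qed

end
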